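(* Let $\widehat{U}^{twist}=U_{K,L,twist}/I$ where $I$ is the two-sided ideal generated by $K^n+L^n-\mathbf{1}$, $E^n$, $F^n$ (with the induced bialgebra structure). Then $$\widehat{R}=\sum_{0\le i,j,m\le n-1}A^{ij}_m(q)\,E^m(K+L)^i\otimes F^m(K+L)^j$$ is a universal $R$-matrix for $\widehat{U}^{twist}$: $\widehat{R}$ is invertible in $\widehat{U}^{twist}\otimes\widehat{U}^{twist}$, $\Delta^{cop}(b)=\widehat{R}\,\Delta(b)\,\widehat{R}^{-1}$ for all $b\in\widehat{U}^{twist}$, and $(\Delta\otimes\mathsf{id})(\widehat{R})=\widehat{R}_{13}\widehat{R}_{23}$, $(\mathsf{id}\otimes\Delta)(\widehat{R})=\widehat{R}_{13}\widehat{R}_{12}$.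
   Context: Let $n>1$ be an odd integer and $q$ a primitive $n$-th root of unity. $U_{K,L,twist}$ is the unital associative $\mathbb{C}$-algebra generated by $K,\overline{K},L,\overline{L},E,F$ subject to $K\overline{K}K=K$, $\overline{K}K\overline{K}=\overline{K}$, $K\overline{K}=\overline{K}K$, $L\overline{L}L=L$, $\overline{L}L\overline{L}=\overline{L}$, $L\overline{L}=\overline{L}L$, $K\overline{K}+L\overline{L}=\mathbf{1}$, $KE=q^2EL$, $LE=q^2EK$, $\overline{K}E=q^{-2}E\overline{L}$, $\overline{L}E=q^{-2}E\overline{K}$, $KF=q^{-2}FL$, $LF=q^{-2}FK$, $\overline{K}F=q^2F\overline{L}$, $\overline{L}F=q^2F\overline{K}$, $EF-FE=\frac{(K+L)-(\overline{K}+\overline{L})}{q-q^{-1}}$, with bialgebra structure given by the algebra homomorphisms $\Delta(K)=K\otimes K+L\otimes L$, $\Delta(\overline{K})=\overline{K}\otimes\overline{K}+\overline{L}\otimes\overline{L}$, $\Delta(L)=L\otimes K+K\otimes L$, $\Delta(\overline{L})=\overline{L}\otimes\overline{K}+\overline{K}\otimes\overline{L}$, $\Delta(E)=\mathbf{1}\otimes E+E\otimes(K+L)$, $\Delta(F)=F\otimes\mathbf{1}+(\overline{K}+\overline{L})\otimes F$, $\varepsilon(K)=\varepsilon(\overline{K})=1$, $\varepsilon(L)=\varepsilon(\overline{L})=\varepsilon(E)=\varepsilon(F)=0$. $\Delta^{cop}=\tau\circ\Delta$ with $\tau$ the flip. Note $(K+L)^i=K^i+L^i$ for $i\ge1$ and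 $(K+L)^0=\mathbf{1}$. The coefficients are $A^{ij}_m(q)=\frac{1}{n}\frac{(q-q^{-1})^m}{[m]!}q^{m(m-1)/2+2m(i-j)-2ij}$, where $[m]=\frac{q^m-q^{-m}}{q-q^{-1}}$ and $[m]!=[1][2]\cdots[m]$. For $R=\sum_i s_i\otimes t_i$: $R_{12}=\sum s_i\otimes t_i\otimes\mathbf{1}$, $R_{13}=\sum s_i\otimes\mathbf{1}\otimes t_i$, $R_{23}=\sum\mathbf{1}\otimes s_i\otimes t_i$. *)

theory Defs
  imports Complex_Main
begin

text \<open>Terms of the free unital associative complex algebra on generators of type 'g.
  Scal c denotes c times the unit.\<close>
datatype 'g alg = Gen 'g | Scal complex | Add "'g alg" "'g alg" | Mul "'g alg" "'g alg"

text \<open>Equality in the quotient of the free unital associative C-algebra by the two-sided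
  ideal generated by the relations Rel: the least congruence containing the unital
  associative C-algebra axioms and the relations.\<close>
inductive alg_eq :: "('g alg \<times> 'g alg) set \<Rightarrow> 'g alg \<Rightarrow> 'g alg \<Rightarrow> bool" for Rel where
  rel: "(a, b) \<in> Rel \<Longrightarrow> alg_eq Rel a b"
| refl: "alg_eq Rel a a"
| sym: "alg_eq Rel a b \<Longrightarrow> alg_eq Rel b a"
| trans: "alg_eq Rel a b \<Longrightarrow> alg_eq Rel b c \<Longrightarrow> alg_eq Rel a c"
| add_cong: "alg_eq Rel a a' \<Longrightarrow> alg_eq Rel b b' \<Longrightarrow> alg_eq Rel (Add a b) (Add a' b')"
| mul_cong: "alg_eq Rel a a' \<Longrightarrow> alg_eq Rel b b' \<Longrightarrow> alg_eq Rel (Mul a b) (Mul a' b')"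
| add_assoc: "alg_eq Rel (Add (Add a b) c) (Add a (Add b c))"
| add_comm: "alg_eq Rel (Add a b) (Add b a)"
| add_zero: "alg_eq Rel (Add (Scal 0) a) a"
| add_neg: "alg_eq Rel (Add a (Mul (Scal (-1)) a)) (Scal 0)"
| mul_assoc: "alg_eq Rel (Mul (Mul a b) c) (Mul a (Mul b c))"
| mul_one_left: "alg_eq Rel (Mul (Scal 1) a) a"
| mul_one_right: "alg_eq Rel (Mul a (Scal 1)) a"
| distrib_left: "alg_eq Rel (Mul a (Add b c)) (Add (Mul a b) (Mul a c))"
| distrib_right: "alg_eq Rel (Mul (Add a b) c) (Add (Mul a c) (Mul b c))"
| scal_add: "alg_eq Rel (Scal (x + y)) (Add (Scal x) (Scal y))"
| scal_mul: "alg_eq Rel (Scal (x * y)) (Mul (Scal x) (Scal y))"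
| scal_central: "alg_eq Rel (Mul (Scal x) a) (Mul a (Scal x))"

primrec alg_subst :: "('g \<Rightarrow> 'h alg) \<Rightarrow> 'g alg \<Rightarrow> 'h alg" where
  "alg_subst f (Gen g) = f g"
| "alg_subst f (Scal c) = Scal c"
| "alg_subst f (Add a b) = Add (alg_subst f a) (alg_subst f b)"
| "alg_subst f (Mul a b) = Mul (alg_subst f a) (alg_subst f b)"

definition alg_relabel :: "('g \<Rightarrow> 'h) \<Rightarrow> 'g alg \<Rightarrow> 'h alg" where
  "alg_relabel f = alg_subst (\<lambda>g. Gen (f g))"

primrec alg_pow :: "'g alg \<Rightarrow> nat \<Rightarrow> 'g alg" where
  "alg_pow a 0 = Scal 1"
| "alg_pow a (Suc k) = Mul a (alg_pow a k)"

definition alg_neg :: "'g alg \<Rightarrow> 'g alg" where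
  "alg_neg a = Mul (Scal (-1)) a"

definition alg_sum :: "'g alg list \<Rightarrow> 'g alg" where
  "alg_sum xs = foldr Add xs (Scal 0)"

datatype gen = K | Kb | L | Lb | E | F

abbreviation G :: "gen \<Rightarrow> gen alg" where "G \<equiv> Gen"

definition Uhat_rel :: "complex \<Rightarrow> nat \<Rightarrow> (gen alg \<times> gen alg) set" where
  "Uhat_rel q n = {
     (Mul (Mul (G K) (G Kb)) (G K), G K),
     (Mul (Mul (G Kb) (G K)) (G Kb), G Kb),
     (Mul (G K) (G Kb), Mul (G Kb) (G K)),
     (Mul (Mul (G L) (G Lb)) (G L), G L),
     (Mul (Mul (G Lb) (G L)) (G Lb), G Lb),
     (Mul (G L) (G Lb), Mul (G Lb) (G L)),
     (Add (Mul (G K) (G Kb)) (Mul (G L) (G Lb)), Scal 1),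
     (Mul (G K) (G E), Mul (Scal (q^2)) (Mul (G E) (G L))),
     (Mul (G L) (G E), Mul (Scal (q^2)) (Mul (G E) (G K))),
     (Mul (G Kb) (G E), Mul (Scal (inverse q ^ 2)) (Mul (G E) (G Lb))),
     (Mul (G Lb) (G E), Mul (Scal (inverse q ^ 2)) (Mul (G E) (G Kb))),
     (Mul (G K) (G F), Mul (Scal (inverse q ^ 2)) (Mul (G F) (G L))),
     (Mul (G L) (G F), Mul (Scal (inverse q ^ 2)) (Mul (G F) (G K))),
     (Mul (G Kb) (G F), Mul (Scal (q^2)) (Mul (G F) (G Lb))),
     (Mul (G Lb) (G F), Mul (Scal (q^2)) (Mul (G F) (G Kb))),
     (Add (Mul (G E) (G F)) (alg_neg (Mul (G F) (G E))),
      Mul (Scal (1 / (q - inverse q)))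
          (Add (Add (G K) (G L)) (alg_neg (Add (G Kb) (G Lb))))),
     \<comment> \<open>generators of the ideal I\<close>
     (Add (alg_pow (G K) n) (Add (alg_pow (G L) n) (alg_neg (Scal 1))), Scal 0),
     (alg_pow (G E) n, Scal 0),
     (alg_pow (G F) n, Scal 0) }"

text \<open>Tensor power: the k-fold tensor product of U-hat with itself, presented by generators
  (i, x) = x placed in the i-th tensor factor (i < k), the relations of U-hat in each factor,
  and commutation of generators in different factors.\<close>
definition tens_rel :: "complex \<Rightarrow> nat \<Rightarrow> nat \<Rightarrow> ((nat \<times> gen) alg \<times> (nat \<times> gen) alg) set" where
  "tens_rel q n k =
     {(alg_relabel (\<lambda>x. (i, x)) a, alg_relabel (\<lambda>x. (i, x)) b) | i a b. i < k \<and> (a, b) \<in> Uhat_rel q n}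
   \<union> {(Mul (Gen (i, x)) (Gen (j, y)), Mul (Gen (j, y)) (Gen (i, x))) | i j x y. i < k \<and> j < k \<and> i \<noteq> j}"

abbreviation T :: "nat \<Rightarrow> gen \<Rightarrow> (nat \<times> gen) alg" where "T i x \<equiv> Gen (i, x)"

definition emb :: "nat \<Rightarrow> gen alg \<Rightarrow> (nat \<times> gen) alg" where
  "emb i a = alg_relabel (\<lambda>x. (i, x)) a"

fun Delta_gen :: "gen \<Rightarrow> (nat \<times> gen) alg" where
  "Delta_gen K = Add (Mul (T 0 K) (T 1 K)) (Mul (T 0 L) (T 1 L))"
| "Delta_gen Kb = Add (Mul (T 0 Kb) (T 1 Kb)) (Mul (T 0 Lb) (T 1 Lb))"
| "Delta_gen L = Add (Mul (T 0 L) (T 1 K)) (Mul (T 0 K) (T 1 L))"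
| "Delta_gen Lb = Add (Mul (T 0 Lb) (T 1 Kb)) (Mul (T 0 Kb) (T 1 Lb))"
| "Delta_gen E = Add (T 1 E) (Mul (T 0 E) (Add (T 1 K) (T 1 L)))"
| "Delta_gen F = Add (T 0 F) (Mul (Add (T 0 Kb) (T 0 Lb)) (T 1 F))"

definition Delta :: "gen alg \<Rightarrow> (nat \<times> gen) alg" where
  "Delta = alg_subst Delta_gen"

definition Delta_cop :: "gen alg \<Rightarrow> (nat \<times> gen) alg" where
  "Delta_cop b = alg_relabel (\<lambda>(i, x). (1 - i, x)) (Delta b)"

definition Delta_id :: "(nat \<times> gen) alg \<Rightarrow> (nat \<times> gen) alg" where
  "Delta_id = alg_subst (\<lambda>(i, x). if i = 0 then Delta_gen x else T 2 x)"

definition id_Delta :: "(nat \<times> gen) alg \<Rightarrow> (nat \<times> gen) alg" where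
  "id_Delta = alg_subst (\<lambda>(i, x). if i = 0 then T 0 x else alg_relabel (\<lambda>(j, y). (Suc j, y)) (Delta_gen x))"

definition legs :: "nat \<Rightarrow> nat \<Rightarrow> (nat \<times> gen) alg \<Rightarrow> (nat \<times> gen) alg" where
  "legs a b = alg_relabel (\<lambda>(i, x). (if i = 0 then a else b, x))"

definition qint :: "complex \<Rightarrow> nat \<Rightarrow> complex" where
  "qint q m = (q ^ m - inverse q ^ m) / (q - inverse q)"

definition qfact :: "complex \<Rightarrow> nat \<Rightarrow> complex" where
  "qfact q m = (\<Prod>k = 1..m. qint q k)"

definition Acoef :: "nat \<Rightarrow> complex \<Rightarrow> nat \<Rightarrow> nat \<Rightarrow> nat \<Rightarrow> complex" where
  "Acoef n q i j m = (1 / of_nat n) * ((q - inverse q) ^ m / qfact q m)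
     * q powi (int (m * (m - 1) div 2) + 2 * int m * (int i - int j) - 2 * int i * int j)"

definition KL :: "gen alg" where "KL = Add (G K) (G L)"

definition R_hat :: "complex \<Rightarrow> nat \<Rightarrow> (nat \<times> gen) alg" where
  "R_hat q n = alg_sum
     [Mul (Scal (Acoef n q i j m))
          (Mul (emb 0 (Mul (alg_pow (G E) m) (alg_pow KL i)))
               (emb 1 (Mul (alg_pow (G F) m) (alg_pow KL j)))).
      i \<leftarrow> [0..<n], j \<leftarrow> [0..<n], m \<leftarrow> [0..<n]]"

definition primitive_root :: "nat \<Rightarrow> complex \<Rightarrow> bool" where
  "primitive_root n q \<longleftrightarrow> q ^ n = 1 \<and> (\<forall>k. 0 < k \<and> k < n \<longrightarrow> q ^ k \<noteq> 1)"

end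

theory Submission
  imports Defs
begin

text \<open>Write \<open>k = K + L\<close>, which is invertible with inverse \<open>Kb + Lb\<close> because the mixed products of
  \<open>K\<close>, \<open>Kb\<close> with \<open>L\<close>, \<open>Lb\<close> vanish; then \<open>k\<close>, \<open>E\<close>, \<open>F\<close> generate a small quantum sl2. Moving the powers of \<open>k\<close> to the
  left factorises the R-matrix as \<open>J(k \<otimes> 1, 1 \<otimes> k) * exp_q(E \<otimes> F)\<close>, where
  \<open>J(a, b)\<close> is the sum of \<open>q^(-2ij) a^i b^j / n\<close>. By discrete Fourier inversion \<open>J(a, b)\<close> is the sum of \<open>a^j e_j\<close> over the
  spectral idempotents \<open>e_j\<close> of \<open>b\<close>, so \<open>J\<close> is multiplicative in each argument and its commutation with \<open>E\<close>, \<open>F\<close>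
  is explicit. The hexagon identities then reduce to \<open>exp_q(u + v) = exp_q(u) exp_q(v)\<close> for
  \<open>u v = q^2 v u\<close>, and quasi-cocommutativity on \<open>E\<close> and \<open>F\<close> to the commutator of \<open>E\<close> with \<open>F^m\<close>.\<close>

section \<open>Presented algebras inside a ring type\<close>

text \<open>Identities are proved in an arbitrary ring with central complex scalars, where ring
  simplification applies, and only afterwards carried over to terms modulo
  \<open>alg_eq\<close>.\<close>

class complex_algebra = ring_1 +
  fixes scaleX :: "complex \<Rightarrow> 'a \<Rightarrow> 'a" (infixr "*c" 75)
  assumes scaleX_add_right: "c *c (a + b) = c *c a + c *c b"
    and scaleX_add_left: "(c + d) *c a = c *c a + d *c a"
    and scaleX_scaleX [simp]: "c *c (d *c a) = (c * d) *c a"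
    and scaleX_one [simp]: "1 *c a = a"
    and mult_scaleX_left [simp]: "(c *c a) * b = c *c (a * b)"
    and mult_scaleX_right [simp]: "a * (c *c b) = c *c (a * b)"
begin

lemma scaleX_zero_left [simp]: "0 *c a = 0"
  using scaleX_add_left[of 0 0 a] by simp

lemma scaleX_zero_right [simp]: "c *c 0 = 0"
  using scaleX_add_right[of c 0 0] by simp

lemma scaleX_minus_left: "(- c) *c a = - (c *c a)"
  using scaleX_add_left[of c "- c" a] by (simp add: eq_neg_iff_add_eq_0 add.commute)

lemma scaleX_minus_right: "c *c (- a) = - (c *c a)"
  using scaleX_add_right[of c a "- a"] by (simp add: eq_neg_iff_add_eq_0 add.commute)

lemma scaleX_diff_right: "c *c (a - b) = c *c a - c *c b"
  using scaleX_add_right[of c a "- b"] by (simp add: scaleX_minus_right)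

lemma scaleX_sum_right: "c *c sum f A = (\<Sum>x\<in>A. c *c f x)"
  by (induction A rule: infinite_finite_induct) (simp_all add: scaleX_add_right)

lemma scaleX_sum_left: "sum f A *c a = (\<Sum>x\<in>A. f x *c a)"
  by (induction A rule: infinite_finite_induct) (simp_all add: scaleX_add_left)

end

section \<open>Powers of commuting, orthogonal and nilpotent elements\<close>

lemma sum_list_concat: "sum_list (concat xss) = sum_list (map sum_list xss)"
  by (induction xss) simp_all

lemma powers_commute:
  fixes a b :: "'a::monoid_mult"
  assumes "a * b = b * a"
  shows "a ^ i * b ^ j = b ^ j * a ^ i"
proof -
  have "a * b ^ j = b ^ j * a"
    by (rule power_commuting_commutes[symmetric]) (simp add: assms)
  then show ?thesis by (rule power_commuting_commutes)
qed

lemma power_mult_distrib_comm: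
  fixes a b :: "'a::monoid_mult"
  assumes "a * b = b * a"
  shows "(a * b) ^ i = a ^ i * b ^ i"
proof (induction i)
  case (Suc i)
  have "b * a ^ i = a ^ i * b"
    using powers_commute[OF assms, of i 1] by simp
  then have "a * b * (a ^ i * b ^ i) = a * a ^ i * (b * b ^ i)"
    by (metis mult.assoc)
  with Suc show ?case by simp
qed simp

lemma assoc_tail: "x * y = z \<Longrightarrow> x * (y * w) = z * (w :: 'a::semigroup_mult)"
  by (simp flip: mult.assoc)

text \<open>Every mixed term of the expansion contains a vanishing product.\<close>

lemma power_add_orthogonal:
  fixes a b :: "'a::semiring_1"
  assumes "a * b = 0" "b * a = 0" "m > 0"
  shows "(a + b) ^ m = a ^ m + b ^ m"
  using assms(3)
proof (induction m rule: nat_induct_non_zero)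
  case (Suc m)
  then obtain l where "m = Suc l" by (cases m) auto
  then have "a * b ^ m = 0" "b * a ^ m = 0"
    using assms by (simp_all flip: mult.assoc)
  then show ?case by (simp add: Suc semiring_class.distrib_left semiring_class.distrib_right)
qed simp

text \<open>All factors \<open>f\<close> can be collected into \<open>f ^ (i + j)\<close>. This
  supplies the vanishing condition of the addition theorem for \<open>qexp\<close>.\<close>

lemma nilpotent_product:
  fixes f x y :: "'a::semiring_1"
  assumes "x * f = f * x" "y * f = f * y" "f ^ n = 0" "i + j \<ge> n"
  shows "(x * f) ^ i * (y * f) ^ j = 0"
proof -
  have "f ^ (i + j) = f ^ n * f ^ (i + j - n)"
    using assms(4) by (simp flip: power_add)
  moreover have "(x * f) ^ i * (y * f) ^ j = x ^ i * y ^ j * f ^ (i + j)"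
    using powers_commute[OF assms(2), of j i, symmetric, THEN assoc_tail, of "f ^ j"]
    by (simp add: power_mult_distrib_comm[OF assms(1)] power_mult_distrib_comm[OF assms(2)] power_add mult.assoc)
  ultimately show ?thesis using assms(3) by simp
qed

instantiation complex :: complex_algebra
begin
definition scaleX_complex :: "complex \<Rightarrow> complex \<Rightarrow> complex" where
  "scaleX_complex c a = c * a"
instance by standard (simp_all add: scaleX_complex_def algebra_simps)
end

section \<open>Evaluation of terms in an algebra\<close>

primrec ev :: "('g \<Rightarrow> 'a::complex_algebra) \<Rightarrow> 'g alg \<Rightarrow> 'a" where
  "ev f (Gen g) = f g"
| "ev f (Scal c) = c *c 1"
| "ev f (Add a b) = ev f a + ev f b"
| "ev f (Mul a b) = ev f a * ev f b"

lemma ev_subst: "ev f (alg_subst s a) = ev (\<lambda>g. ev f (s g)) a"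
  by (induction a) simp_all

lemma ev_relabel: "ev f (alg_relabel s a) = ev (\<lambda>g. f (s g)) a"
  by (simp add: alg_relabel_def ev_subst)

lemma ev_pow [simp]: "ev f (alg_pow a m) = ev f a ^ m"
  by (induction m) simp_all

lemma ev_neg [simp]: "ev f (alg_neg a) = - ev f a"
  by (simp add: alg_neg_def scaleX_minus_left)

lemma ev_sum [simp]: "ev f (alg_sum xs) = sum_list (map (ev f) xs)"
  by (induction xs) (simp_all add: alg_sum_def)

text \<open>Each closure rule of \<open>alg_eq\<close> is valid in every complex algebra. Below this
  serves to separate 0 from 1.\<close>

lemma ev_sound:
  assumes "alg_eq Rel a b" and "\<And>s t. (s, t) \<in> Rel \<Longrightarrow> ev f s = ev f t"
  shows "ev f a = ev f b"
  using assms(1)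
  by induction (simp_all add: assms(2) algebra_simps scaleX_add_left scaleX_minus_left)

lemma scale_term_add: "alg_eq Rel (Mul (Scal (x + y)) a) (Add (Mul (Scal x) a) (Mul (Scal y) a))"
  by (meson alg_eq.scal_add alg_eq.mul_cong alg_eq.refl alg_eq.trans alg_eq.distrib_right)

text \<open>The quotient by \<open>Rel\<close> depends on a value and is therefore not a type. The following type is
  the product of the quotients over all sets of relations at once.\<close>

quotient_type 'g palg = "('g alg \<times> 'g alg) set \<Rightarrow> 'g alg" /
  "\<lambda>f g. \<forall>R. alg_eq R (f R) (g R)"
  by (rule equivpI) (auto intro!: reflpI sympI transpI intro: alg_eq.refl alg_eq.sym alg_eq.trans)

instantiation palg :: (type) complex_algebra
begin

lift_definition zero_palg :: "'a palg" is "\<lambda>R. Scal 0" .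
lift_definition one_palg :: "'a palg" is "\<lambda>R. Scal 1" .
lift_definition plus_palg :: "'a palg \<Rightarrow> 'a palg \<Rightarrow> 'a palg" is "\<lambda>f g R. Add (f R) (g R)"
  by (simp add: alg_eq.add_cong)
lift_definition times_palg :: "'a palg \<Rightarrow> 'a palg \<Rightarrow> 'a palg" is "\<lambda>f g R. Mul (f R) (g R)"
  by (simp add: alg_eq.mul_cong)
lift_definition scaleX_palg :: "complex \<Rightarrow> 'a palg \<Rightarrow> 'a palg" is "\<lambda>c f R. Mul (Scal c) (f R)"
  by (simp add: alg_eq.mul_cong alg_eq.refl)
lift_definition uminus_palg :: "'a palg \<Rightarrow> 'a palg" is "\<lambda>f R. Mul (Scal (-1)) (f R)"
  by (simp add: alg_eq.mul_cong alg_eq.refl)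
definition minus_palg :: "'a palg \<Rightarrow> 'a palg \<Rightarrow> 'a palg" where
  "minus_palg a b = a + - b"

instance
proof
  fix a b c :: "'a palg" and x y :: complex
  show "a * b * c = a * (b * c)" by transfer (simp add: alg_eq.mul_assoc)
  show "1 * a = a" by transfer (simp add: alg_eq.mul_one_left)
  show "a * 1 = a" by transfer (simp add: alg_eq.mul_one_right)
  show "a + b + c = a + (b + c)" by transfer (simp add: alg_eq.add_assoc)
  show "a + b = b + a" by transfer (simp add: alg_eq.add_comm)
  show "0 + a = a" by transfer (simp add: alg_eq.add_zero)
  show "- a + a = 0" by transfer (meson alg_eq.add_comm alg_eq.add_neg alg_eq.trans)
  show "a - b = a + - b" by (rule minus_palg_def)
  show "(a + b) * c = a * c + b * c" by transfer (simp add: alg_eq.distrib_right)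
  show "a * (b + c) = a * b + a * c" by transfer (simp add: alg_eq.distrib_left)
  show "x *c (a + b) = x *c a + x *c b" by transfer (simp add: alg_eq.distrib_left)
  show "(x + y) *c a = x *c a + y *c a" by transfer (simp add: scale_term_add)
  show "x *c (y *c a) = (x * y) *c a"
    by transfer (meson alg_eq.mul_assoc alg_eq.mul_cong alg_eq.refl alg_eq.scal_mul alg_eq.sym alg_eq.trans)
  show "1 *c a = a" by transfer (simp add: alg_eq.mul_one_left)
  show "(x *c a) * b = x *c (a * b)" by transfer (simp add: alg_eq.mul_assoc)
  show "a * (x *c b) = x *c (a * b)"
    by transfer (meson alg_eq.mul_assoc alg_eq.mul_cong alg_eq.refl alg_eq.scal_central alg_eq.sym alg_eq.trans)
  show "(0::'a palg) \<noteq> 1"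
  proof transfer
    \<comment> \<open>Elements of the product differ once one component differs. The component at
      the empty set is the free algebra, which the zero assignment maps to the complex
      numbers.\<close>
    have "\<not> alg_eq {} (Scal 0 :: 'a alg) (Scal 1)"
      using ev_sound[of "{}" "Scal 0 :: 'a alg" "Scal 1" "\<lambda>_. 0 :: complex"] by auto
    then show "\<not> (\<forall>R. alg_eq R (Scal 0 :: 'a alg) (Scal 1))" by blast
  qed
qed

end

text \<open>A one-dimensional representation \<open>\<chi>\<close> of the presented algebra is used at all indices other than
  \<open>Rel\<close>, so that the relations \<open>Rel\<close> hold in the whole product.\<close>

lift_definition class_at :: "('g alg \<times> 'g alg) set \<Rightarrow> ('g \<Rightarrow> complex) \<Rightarrow> 'g alg \<Rightarrow> 'g palg"
  is "\<lambda>Rel \<chi> a R. if R = Rel then a else Scal (ev \<chi> a)" .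

lemma class_at_eqD: "class_at Rel \<chi> a = class_at Rel \<chi> b \<Longrightarrow> alg_eq Rel a b"
  by transfer metis

lemma class_at_eqI: "alg_eq Rel a b \<Longrightarrow> ev \<chi> a = ev \<chi> b \<Longrightarrow> class_at Rel \<chi> a = class_at Rel \<chi> b"
  by transfer (simp add: alg_eq.refl)

text \<open>\<open>class_at\<close> is a homomorphism: at the index \<open>Rel\<close> by
  construction, elsewhere because evaluation at \<open>\<chi>\<close> is one and
  \<open>alg_eq\<close> respects scalar arithmetic.\<close>

lemma class_at_ev: "class_at Rel \<chi> a = ev (\<lambda>g. class_at Rel \<chi> (Gen g)) a"
proof (induction a)
  case (Scal c)
  show ?case
    by (simp, transfer) (auto simp: scaleX_complex_def intro: alg_eq.mul_one_right alg_eq.sym)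
next
  case (Add a b)
  have "class_at Rel \<chi> (Add a b) = class_at Rel \<chi> a + class_at Rel \<chi> b"
    by transfer (auto intro: alg_eq.refl alg_eq.scal_add)
  with Add show ?case by simp
next
  case (Mul a b)
  have "class_at Rel \<chi> (Mul a b) = class_at Rel \<chi> a * class_at Rel \<chi> b"
    by transfer (auto intro: alg_eq.refl alg_eq.scal_mul)
  with Mul show ?case by simp
qed simp

section \<open>Roots of unity and q-exponentials\<close>

locale root_of_unity =
  fixes n :: nat and q :: complex
  assumes n_gt_1: "n > 1" and odd_n: "odd n" and prim: "primitive_root n q"
begin

abbreviation iq :: complex where "iq \<equiv> inverse q"

lemma q_power_n: "q ^ n = 1"
  using prim by (simp add: primitive_root_def)

lemma q_nonzero [simp]: "q \<noteq> 0"
  using q_power_n n_gt_1 by (auto simp: power_0_left)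

lemma q_iq_power: "q ^ m * iq ^ m = 1"
  by (simp flip: power_mult_distrib)

lemma q_iq_square [simp]: "q\<^sup>2 * iq\<^sup>2 = 1" "iq\<^sup>2 * q\<^sup>2 = 1"
  using q_iq_power[of 2] by (simp_all add: mult.commute)

text \<open>Because \<open>n\<close> is odd, \<open>q^2\<close> is again a primitive
  \<open>n\<close>-th root of unity: \<open>2 * m\<close> never equals \<open>n\<close>, and when it
  exceeds \<open>n\<close> it can be reduced by \<open>n\<close>.\<close>

lemma q_even_power_neq_1:
  assumes "0 < m" "m < n"
  shows "q ^ (2 * m) \<noteq> 1"
proof (cases "2 * m < n")
  case True
  then show ?thesis using prim assms by (auto simp: primitive_root_def)
next
  case False
  have "2 * m \<noteq> n" using odd_n by auto
  with False have "0 < 2 * m - n" "2 * m - n < n" using assms by auto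
  then have "q ^ (2 * m - n) \<noteq> 1" using prim by (auto simp: primitive_root_def)
  moreover have "q ^ (2 * m) = q ^ (2 * m - n) * q ^ n"
    using False by (simp flip: power_add)
  ultimately show ?thesis by (simp add: q_power_n)
qed

lemma iq_even_power_neq_1:
  assumes "0 < m" "m < n"
  shows "iq ^ (2 * m) \<noteq> 1"
  using q_even_power_neq_1[OF assms] by (simp add: power_inverse)

lemma q_even_power_inj:
  assumes "j < n" "l < n" "q ^ (2 * j) = q ^ (2 * l)"
  shows "j = l"
  using assms
proof (induction j l rule: linorder_wlog)
  case (le j l)
  have "2 * l = 2 * j + 2 * (l - j)" using le(1) by simp
  then have "q ^ (2 * l) = q ^ (2 * j) * q ^ (2 * (l - j))"
    by (metis power_add)
  with le have "q ^ (2 * (l - j)) = 1" by simp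
  with q_even_power_neq_1[of "l - j"] le show ?case by force
qed auto

text \<open>A geometric sum in \<open>w = q^(2(l - j))\<close>, an \<open>n\<close>-th root of unity
  which is 1 only for \<open>j = l\<close>.\<close>

lemma root_of_unity_orthogonality:
  assumes "j < n" "l < n"
  shows "(\<Sum>i<n. iq ^ (2 * i * j) * q ^ (2 * i * l)) = (if j = l then of_nat n else 0)"
proof -
  define w where "w = iq ^ (2 * j) * q ^ (2 * l)"
  have term_eq: "iq ^ (2 * i * j) * q ^ (2 * i * l) = w ^ i" for i
    by (simp add: w_def power_mult_distrib mult_ac flip: power_mult)
  have "w ^ n = (iq ^ n) ^ (2 * j) * (q ^ n) ^ (2 * l)"
    by (simp add: w_def power_mult_distrib mult_ac flip: power_mult)
  then have wn: "w ^ n = 1" by (simp add: q_power_n power_inverse)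
  show ?thesis
  proof (cases "j = l")
    case True
    then have "w = 1" by (simp add: w_def power_inverse)
    with True show ?thesis unfolding term_eq by simp
  next
    case False
    have "w \<noteq> 1"
    proof
      assume "w = 1"
      then have "q ^ (2 * j) = q ^ (2 * l)" by (simp add: w_def power_inverse field_simps)
      with q_even_power_inj assms False show False by blast
    qed
    moreover have "(1 - w) * (\<Sum>i<n. w ^ i) = 0"
      using one_diff_power_eq[of w n] wn by simp
    ultimately show ?thesis using False by (simp add: term_eq)
  qed
qed

subsection \<open>The Cartan part of the R-matrix\<close>

text \<open>The discrete Fourier transform of the powers of \<open>b\<close>. If
  \<open>b ^ n = 1\<close>, it is the spectral projection of \<open>b\<close> for the eigenvalue
  \<open>q ^ (2 * j)\<close>.\<close>

definition idem :: "'a::complex_algebra \<Rightarrow> nat \<Rightarrow> 'a" where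
  "idem b j = (\<Sum>i<n. (iq ^ (2 * i * j) / of_nat n) *c b ^ i)"

text \<open>This is \<open>J(a, b)\<close> of the overview, with negative powers of \<open>q\<close>
  written through \<open>iq\<close>.\<close>

definition cartan :: "'a::complex_algebra \<Rightarrow> 'a \<Rightarrow> 'a" where
  "cartan a b = (\<Sum>i<n. \<Sum>j<n. (iq ^ (2 * i * j) / of_nat n) *c (a ^ i * b ^ j))"

lemma cartan_idem: "cartan a b = (\<Sum>j<n. a ^ j * idem b j)"
  by (simp add: cartan_def idem_def sum_distrib_left mult_ac)

lemma cartan_sym: "a * b = b * a \<Longrightarrow> cartan a b = cartan b a"
  unfolding cartan_def
  by (subst sum.swap) (simp add: powers_commute mult_ac)

lemma idem_commute: "a * b = b * a \<Longrightarrow> a * idem b j = idem b j * a"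
  using powers_commute[of a b 1]
  by (simp add: idem_def sum_distrib_left sum_distrib_right)

text \<open>Multiplication by \<open>b\<close> shifts the summation index, and the summand is
  periodic modulo \<open>n\<close>.\<close>

lemma idem_eigen:
  assumes "b ^ n = 1"
  shows "b * idem b j = q ^ (2 * j) *c idem b j"
proof -
  define g where "g i = (q ^ (2 * j) * iq ^ (2 * i * j) / of_nat n) *c b ^ i" for i
  have "iq ^ (2 * n * j) = (iq ^ n) ^ (2 * j)"
    by (simp add: mult_ac flip: power_mult)
  then have "g n = g 0"
    by (simp add: g_def assms power_inverse q_power_n)
  then have "(\<Sum>i<n. g (Suc i)) = (\<Sum>i<n. g i)"
    using sum.lessThan_Suc_shift[of g n] by (simp add: add.commute)
  moreover have "g (Suc i) = (iq ^ (2 * i * j) / of_nat n) *c (b * b ^ i)" for i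
  proof -
    have "iq ^ (2 * Suc i * j) = iq ^ (2 * j) * iq ^ (2 * i * j)"
      by (simp add: algebra_simps flip: power_add)
    then have "q ^ (2 * j) * iq ^ (2 * Suc i * j) = iq ^ (2 * i * j)"
      by (simp only: mult.assoc[symmetric] q_iq_power mult_1)
    then show ?thesis by (simp only: g_def power_Suc)
  qed
  ultimately show ?thesis
    by (simp add: idem_def g_def sum_distrib_left scaleX_sum_right)
qed

lemma idem_eigen_power:
  assumes "b ^ n = 1"
  shows "b ^ i * idem b j = q ^ (2 * i * j) *c idem b j"
proof (induction i)
  case (Suc i)
  have "b ^ Suc i * idem b j = b * (b ^ i * idem b j)" by (simp add: mult.assoc)
  also have "\<dots> = (q ^ (2 * i * j) * q ^ (2 * j)) *c idem b j"
    by (simp only: Suc mult_scaleX_right idem_eigen[OF assms] scaleX_scaleX)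
  finally show ?case by (simp add: algebra_simps flip: power_add)
qed simp

lemma idem_eigen_inverse:
  assumes "b ^ n = 1" "bi * b = 1"
  shows "bi * idem b j = iq ^ (2 * j) *c idem b j"
proof -
  have "idem b j = bi * (b * idem b j)" by (simp add: assms flip: mult.assoc)
  also have "\<dots> = q ^ (2 * j) *c (bi * idem b j)" by (simp add: idem_eigen[OF assms(1)])
  finally have "iq ^ (2 * j) *c idem b j = iq ^ (2 * j) *c (q ^ (2 * j) *c (bi * idem b j))" by simp
  then show ?thesis by (simp add: power_inverse)
qed

text \<open>Expanding only the left factor makes each \<open>b ^ i\<close> act on
  \<open>idem b l\<close> by a scalar; the scalars add up to the orthogonality sum.\<close>

lemma idem_orthogonal:
  assumes "b ^ n = 1" "j < n" "l < n"
  shows "idem b j * idem b l = (if j = l then idem b l else 0)"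
proof -
  have "idem b j * idem b l = (\<Sum>i<n. (iq ^ (2 * i * j) * q ^ (2 * i * l) / of_nat n) *c idem b l)"
    unfolding idem_def[of b j] by (simp add: sum_distrib_right idem_eigen_power[OF assms(1)])
  also have "\<dots> = ((\<Sum>i<n. iq ^ (2 * i * j) * q ^ (2 * i * l)) / of_nat n) *c idem b l"
    by (simp add: scaleX_sum_left sum_divide_distrib)
  finally show ?thesis
    using n_gt_1 by (simp add: root_of_unity_orthogonality[OF assms(2,3)])
qed

lemma idem_sum: "(\<Sum>j<n. idem b j) = 1"
proof -
  have "(\<Sum>j<n. idem b j) = (\<Sum>i<n. ((\<Sum>j<n. iq ^ (2 * i * j)) / of_nat n) *c b ^ i)"
    unfolding idem_def by (subst sum.swap) (simp add: scaleX_sum_left sum_divide_distrib)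
  also have "\<dots> = (\<Sum>i<n. if i = 0 then 1 else 0)"
  proof (rule sum.cong[OF HOL.refl])
    fix i assume "i \<in> {..<n}"
    then have "(\<Sum>j<n. iq ^ (2 * i * j)) = (if i = 0 then of_nat n else 0)"
      using root_of_unity_orthogonality[of i 0] n_gt_1 by (simp add: mult_ac)
    then show "((\<Sum>j<n. iq ^ (2 * i * j)) / of_nat n) *c b ^ i = (if i = 0 then 1 else 0)"
      using n_gt_1 by simp
  qed
  finally show ?thesis using n_gt_1 by (simp add: sum.delta)
qed

lemma cartan_one: "cartan 1 b = 1"
  by (simp add: cartan_idem idem_sum)

lemma cartan_commute:
  assumes "d * a = a * d" "d * b = b * d"
  shows "d * cartan a b = cartan a b * d"
proof -
  have "d * (a ^ i * b ^ j) = a ^ i * b ^ j * d" for i j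
  proof -
    have "d * a ^ i = a ^ i * d" "d * b ^ j = b ^ j * d"
      using powers_commute[OF assms(1), of 1 i] powers_commute[OF assms(2), of 1 j] by simp_all
    then show ?thesis by (metis mult.assoc)
  qed
  then show ?thesis by (simp add: cartan_def sum_distrib_left sum_distrib_right)
qed

text \<open>In the expansion over the idempotents of \<open>b\<close> only the diagonal terms of the
  product survive.\<close>

lemma cartan_mult:
  assumes "b ^ n = 1" "a' * b = b * a'" "a * a' = a' * a"
  shows "cartan a b * cartan a' b = cartan (a * a') b"
proof -
  have *: "a ^ i * idem b i * (a' ^ j * idem b j) = (if j = i then (a * a') ^ i * idem b i else 0)"
    if "i < n" "j < n" for i j
  proof -
    have "a' ^ j * b = b * a' ^ j" using powers_commute[OF assms(2), of j 1] by simp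
    then have "a ^ i * idem b i * (a' ^ j * idem b j) = a ^ i * a' ^ j * (idem b i * idem b j)"
      by (metis idem_commute mult.assoc)
    then show ?thesis
      by (simp add: idem_orthogonal[OF assms(1) that] power_mult_distrib_comm[OF assms(3)])
  qed
  have "cartan a b * cartan a' b = (\<Sum>i<n. \<Sum>j<n. a ^ i * idem b i * (a' ^ j * idem b j))"
    by (simp add: cartan_idem sum_product)
  also have "\<dots> = (\<Sum>i<n. \<Sum>j<n. if j = i then (a * a') ^ i * idem b i else 0)"
    by (intro sum.cong HOL.refl) (simp add: *)
  finally show ?thesis by (simp add: cartan_idem)
qed

lemma shift_power:
  fixes a z :: "'a::complex_algebra"
  assumes "z * a = c *c (a * z)"
  shows "z * a ^ j = c ^ j *c (a ^ j * z)"
proof (induction j)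
  case (Suc j)
  have "z * a ^ Suc j = (z * a) * a ^ j" by (simp add: mult.assoc)
  also have "\<dots> = c *c (a * (z * a ^ j))" by (simp add: assms mult.assoc)
  finally show ?case by (simp add: Suc mult.assoc)
qed simp

text \<open>Moving \<open>z\<close> past \<open>a ^ j\<close> costs \<open>q ^ (2 * j)\<close>,
  which is exactly the eigenvalue of \<open>b\<close> on \<open>idem b j\<close>; the scalar is
  therefore absorbed as one factor \<open>b\<close>, independent of \<open>j\<close>.\<close>

lemma cartan_shift:
  assumes "b ^ n = 1" "z * a = q\<^sup>2 *c (a * z)" "z * b = b * z"
  shows "z * cartan a b = cartan a b * (b * z)"
proof -
  have "z * (a ^ j * idem b j) = a ^ j * idem b j * (b * z)" for j
  proof -
    have "z * (a ^ j * idem b j) = q ^ (2 * j) *c (a ^ j * (z * idem b j))"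
      using shift_power[OF assms(2), of j] by (simp add: power_mult mult.assoc flip: mult.assoc[of z])
    also have "\<dots> = a ^ j * (q ^ (2 * j) *c idem b j) * z"
      by (simp add: idem_commute[OF assms(3)] mult.assoc)
    also have "\<dots> = a ^ j * (idem b j * b) * z"
      by (simp flip: idem_eigen[OF assms(1)] add: idem_commute)
    finally show ?thesis by (simp add: mult.assoc)
  qed
  then show ?thesis by (simp add: cartan_idem sum_distrib_left sum_distrib_right)
qed

text \<open>As in \<open>cartan_shift\<close>, with the inverse eigenvalue absorbed as a factor
  \<open>bi\<close>.\<close>

lemma cartan_shift_inverse:
  assumes "b ^ n = 1" "z * a = iq\<^sup>2 *c (a * z)" "z * b = b * z" "bi * b = 1" "b * bi = 1"
  shows "z * cartan a b = cartan a b * (bi * z)"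
proof -
  have "z * (a ^ j * idem b j) = a ^ j * idem b j * (bi * z)" for j
  proof -
    have "z * (a ^ j * idem b j) = iq ^ (2 * j) *c (a ^ j * (z * idem b j))"
      using shift_power[OF assms(2), of j] by (simp add: power_mult mult.assoc flip: mult.assoc[of z])
    also have "\<dots> = a ^ j * (iq ^ (2 * j) *c idem b j) * z"
      by (simp add: idem_commute[OF assms(3)] mult.assoc)
    also have "\<dots> = a ^ j * (idem b j * bi) * z"
      by (simp flip: idem_eigen_inverse[OF assms(1,4)] add: idem_commute assms)
    finally show ?thesis by (simp add: mult.assoc)
  qed
  then show ?thesis by (simp add: cartan_idem sum_distrib_left sum_distrib_right)
qed

subsection \<open>The quasi-R-matrix\<close>

definition cf :: "nat \<Rightarrow> complex" where
  "cf m = (q - iq) ^ m / qfact q m * q ^ (m * (m - 1) div 2)"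

text \<open>The \<open>q\<close>-exponential \<open>exp_q\<close> of the overview, cut off at
  \<open>n\<close>, beyond which powers of the intended arguments vanish and
  \<open>q\<close>-factorials are no longer invertible.\<close>

definition qexp :: "'a::complex_algebra \<Rightarrow> 'a" where
  "qexp x = (\<Sum>m<n. cf m *c x ^ m)"

lemma q_minus_iq_nonzero [simp]: "q - iq \<noteq> 0"
proof
  assume "q - iq = 0"
  then have "q ^ (2 * 1) = 1" by (simp add: power2_eq_square field_simps)
  with q_even_power_neq_1[of 1] n_gt_1 show False by simp
qed

lemma qint_nonzero:
  assumes "0 < m" "m < n"
  shows "qint q m \<noteq> 0"
proof
  assume "qint q m = 0"
  then have "q ^ m = iq ^ m" using q_minus_iq_nonzero by (auto simp: qint_def)
  then have "q ^ m * q ^ m = 1" using q_iq_power[of m] by simp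
  then have "q ^ (2 * m) = 1" by (simp add: mult_2 power_add)
  with q_even_power_neq_1[OF assms] show False by simp
qed

lemma cf_0 [simp]: "cf 0 = 1"
  by (simp add: cf_def qfact_def)

lemma cf_Suc:
  assumes "Suc m < n"
  shows "cf (Suc m) * qint q (Suc m) = (q - iq) * q ^ m * cf m"
proof -
  have "Suc m * m div 2 = m + m * (m - 1) div 2"
    by (cases m) (simp_all add: algebra_simps)
  then have "q ^ (Suc m * (Suc m - 1) div 2) = q ^ m * q ^ (m * (m - 1) div 2)"
    by (simp add: power_add)
  moreover have "qfact q (Suc m) = qfact q m * qint q (Suc m)"
    by (simp add: qfact_def)
  ultimately show ?thesis
    using qint_nonzero[of "Suc m"] assms by (simp add: cf_def)
qed

text \<open>A form of the recursion whose factor on the right does not depend on \<open>m\<close>;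
  this drives the induction in \<open>qexp_binomial\<close>.\<close>

lemma cf_Suc':
  assumes "Suc m < n"
  shows "(1 - iq ^ (2 * Suc m)) * cf (Suc m) = (q - iq)\<^sup>2 * iq * cf m"
proof -
  have "q ^ Suc m * (1 - iq ^ (2 * Suc m)) = q ^ Suc m - iq ^ Suc m"
    by (simp only: mult_2 power_add right_diff_distrib mult.assoc[symmetric] q_iq_power) simp
  also have "\<dots> = (q - iq) * qint q (Suc m)"
    by (simp add: qint_def)
  finally have "q ^ Suc m * ((1 - iq ^ (2 * Suc m)) * cf (Suc m)) = (q - iq) * ((q - iq) * q ^ m * cf m)"
    using cf_Suc[OF assms] by (simp add: mult_ac)
  also have "\<dots> = q ^ Suc m * ((q - iq)\<^sup>2 * iq * cf m)"
    by (simp add: power2_eq_square)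
  finally show ?thesis by simp
qed

text \<open>The \<open>q\<close>-binomial theorem divided by \<open>q\<close>-factorials. Both sides
  are multiplied by \<open>1 - p (Suc m)\<close>; the terms starting with \<open>u\<close>
  contribute \<open>1 - p i\<close>, those starting with \<open>v\<close> contribute
  \<open>p i - p (Suc m)\<close>, and the sum is the constant \<open>1 - p (Suc m)\<close>, which is
  nonzero for \<open>Suc m < n\<close>.\<close>

lemma qexp_binomial:
  fixes u v :: "'a::complex_algebra"
  assumes vu: "v * u = iq\<^sup>2 *c (u * v)" and "m < n"
  shows "cf m *c (u + v) ^ m = (\<Sum>i\<le>m. (cf i * cf (m - i)) *c (u ^ i * v ^ (m - i)))"
  using assms(2)
proof (induction m)
  case (Suc m)
  define C where "C = (q - iq)\<^sup>2 * iq"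
  define p where "p i = iq ^ (2 * i)" for i
  define g where "g i = u ^ i * v ^ (Suc m - i)" for i
  have rec: "C * cf i = (1 - p (Suc i)) * cf (Suc i)" if "i \<le> m" for i
    using cf_Suc'[of i] Suc.prems that by (simp add: C_def p_def)
  have vui: "v * u ^ i = p i *c (u ^ i * v)" for i
    using shift_power[OF vu, of i] by (simp add: p_def power_mult)
  let ?a = "\<lambda>i. (cf i * cf (Suc m - i))"
  have "(1 - p (Suc m)) *c (cf (Suc m) *c (u + v) ^ Suc m) = C *c ((u + v) * (cf m *c (u + v) ^ m))"
    by (simp add: rec[of m])
  also have "\<dots> = (\<Sum>i\<le>m. (C * (cf i * cf (m - i))) *c (u * (u ^ i * v ^ (m - i))))
      + (\<Sum>i\<le>m. (C * (cf i * cf (m - i))) *c (v * (u ^ i * v ^ (m - i))))"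
    using Suc by (simp add: semiring_class.distrib_right sum_distrib_left scaleX_sum_right scaleX_add_right sum.distrib)
  also have "(\<Sum>i\<le>m. (C * (cf i * cf (m - i))) *c (u * (u ^ i * v ^ (m - i))))
      = (\<Sum>i\<le>m. ((1 - p (Suc i)) * ?a (Suc i)) *c g (Suc i))"
    by (intro sum.cong HOL.refl) (simp add: rec g_def mult.assoc flip: mult.assoc[of C])
  \<comment> \<open>The new term at \<open>i = 0\<close> vanishes because
    \<open>p 0 = 1\<close>.\<close>
  also have "\<dots> = (\<Sum>i\<le>Suc m. ((1 - p i) * ?a i) *c g i)"
    by (simp add: sum.atMost_Suc_shift p_def del: sum.atMost_Suc)
  also have "(\<Sum>i\<le>m. (C * (cf i * cf (m - i))) *c (v * (u ^ i * v ^ (m - i))))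
      = (\<Sum>i\<le>m. ((p i - p (Suc m)) * ?a i) *c g i)"
  proof (intro sum.cong HOL.refl)
    fix i assume "i \<in> {..m}"
    then have i: "i \<le> m" by simp
    have "v * (u ^ i * v ^ (m - i)) = p i *c g i"
      using i by (simp add: g_def vui Suc_diff_le flip: mult.assoc)
    moreover have "C * (cf i * cf (m - i)) * p i = (p i - p (Suc m)) * ?a i"
    proof -
      have "p i * p (Suc (m - i)) = p (Suc m)"
        using i by (simp add: p_def flip: power_add distrib_left_numeral)
      moreover have "C * (cf i * cf (m - i)) * p i = p i * cf i * (C * cf (m - i))"
        by simp
      ultimately show ?thesis
        using i by (simp only: rec[of "m - i"] diff_le_self Suc_diff_le) (simp add: algebra_simps)
    qed
    ultimately show "(C * (cf i * cf (m - i))) *c (v * (u ^ i * v ^ (m - i)))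
        = ((p i - p (Suc m)) * ?a i) *c g i"
      by (simp only: mult_scaleX_right scaleX_scaleX)
  qed
  \<comment> \<open>The new term at \<open>i = Suc m\<close> has coefficient zero.\<close>
  also have "\<dots> = (\<Sum>i\<le>Suc m. ((p i - p (Suc m)) * ?a i) *c g i)"
    by simp
  also have "(\<Sum>i\<le>Suc m. ((1 - p i) * ?a i) *c g i) + (\<Sum>i\<le>Suc m. ((p i - p (Suc m)) * ?a i) *c g i)
      = (\<Sum>i\<le>Suc m. (1 - p (Suc m)) *c (?a i *c g i))"
    by (simp only: sum.distrib[symmetric] scaleX_add_left[symmetric])
       (simp add: algebra_simps)
  also have "\<dots> = (1 - p (Suc m)) *c (\<Sum>i\<le>Suc m. ?a i *c g i)"
    by (simp only: scaleX_sum_right)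
  finally have *: "(1 - p (Suc m)) *c (cf (Suc m) *c (u + v) ^ Suc m)
      = (1 - p (Suc m)) *c (\<Sum>i\<le>Suc m. ?a i *c g i)" .
  have "1 - p (Suc m) \<noteq> 0"
    using iq_even_power_neq_1[of "Suc m"] Suc.prems by (simp add: p_def)
  then have "inverse (1 - p (Suc m)) *c (1 - p (Suc m)) *c x = x" for x :: 'a
    by simp
  with * show ?case unfolding g_def by metis
qed simp

text \<open>The binomial formula covers the triangle \<open>i + j < n\<close>; the rest of the
  square of index pairs vanishes by \<open>nil\<close>.\<close>

lemma qexp_add:
  fixes u v :: "'a::complex_algebra"
  assumes vu: "v * u = iq\<^sup>2 *c (u * v)" and nil: "\<And>i j. i + j \<ge> n \<Longrightarrow> u ^ i * v ^ j = 0"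
  shows "qexp (u + v) = qexp u * qexp v"
proof -
  let ?g = "\<lambda>i j. (cf i * cf j) *c (u ^ i * v ^ j)"
  have "qexp (u + v) = (\<Sum>m<n. \<Sum>i\<le>m. ?g i (m - i))"
    unfolding qexp_def by (intro sum.cong HOL.refl) (simp add: qexp_binomial[OF vu])
  also have "\<dots> = (\<Sum>(i, j)\<in>{(i, j). i + j < n}. ?g i j)"
    by (rule sum.triangle_reindex[symmetric])
  also have "\<dots> = (\<Sum>(i, j)\<in>{..<n} \<times> {..<n}. ?g i j)"
    by (rule sum.mono_neutral_left) (auto, metis leI nil scaleX_zero_right)
  also have "\<dots> = qexp u * qexp v"
    by (simp add: qexp_def sum_product sum.cartesian_product mult.commute[of "cf _" "cf _"])
  finally show ?thesis .
qed

lemma qexp_intertwine: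
  fixes x y z :: "'a::complex_algebra"
  assumes "x * z = z * y"
  shows "qexp x * z = z * qexp y"
proof -
  have "x ^ m * z = z * y ^ m" for m
  proof (induction m)
    case (Suc m)
    have "x ^ Suc m * z = x * (x ^ m * z)" by (simp add: mult.assoc)
    also have "\<dots> = x * z * y ^ m" by (simp add: Suc mult.assoc)
    finally show ?case by (simp add: assms mult.assoc)
  qed simp
  then show ?thesis by (simp add: qexp_def sum_distrib_left sum_distrib_right)
qed

text \<open>A finite Neumann series, justified by the nilpotency of \<open>1 - qexp x\<close> for
  nilpotent \<open>x\<close>.\<close>

definition qexp_inv :: "'a::complex_algebra \<Rightarrow> 'a" where
  "qexp_inv x = (\<Sum>i<n. (1 - qexp x) ^ i)"

lemma qexp_inverse:
  fixes x :: "'a::complex_algebra"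
  assumes "x ^ n = 0"
  shows "qexp x * qexp_inv x = 1" "qexp_inv x * qexp x = 1"
proof -
  \<comment> \<open>Since \<open>cf 0 = 1\<close>, one factor \<open>x\<close> splits off from
    \<open>1 - qexp x\<close>; the cofactor \<open>h\<close> commutes with \<open>x\<close>, so
    nilpotency is inherited.\<close>
  define h where "h = - (\<Sum>m<n - 1. cf (Suc m) *c x ^ m)"
  have "{..<n} = {..<Suc (n - 1)}" using n_gt_1 by simp
  then have "qexp x = 1 + (\<Sum>m<n - 1. cf (Suc m) *c x ^ Suc m)"
    unfolding qexp_def by (simp only: sum.lessThan_Suc_shift) simp
  then have h: "1 - qexp x = x * h"
    by (simp add: h_def sum_distrib_left)
  have "x * h = h * x"
    by (simp add: h_def sum_distrib_left sum_distrib_right power_commutes)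
  then have nil: "(1 - qexp x) ^ n = 0"
    by (simp add: h power_mult_distrib_comm assms)
  have "qexp_inv x * (1 - qexp x) = (1 - qexp x) * qexp_inv x"
    by (simp add: qexp_inv_def sum_distrib_left sum_distrib_right power_commutes)
  then have comm: "qexp_inv x * qexp x = qexp x * qexp_inv x"
    by (simp add: algebra_simps)
  have "(1 - y) * (\<Sum>i<m. y ^ i) = 1 - y ^ m" for y :: 'a and m
  proof (induction m)
    case (Suc m)
    have "(1 - y) * (\<Sum>i<Suc m. y ^ i) = 1 - y ^ m + (1 - y) * y ^ m"
      by (simp only: sum.lessThan_Suc semiring_class.distrib_left Suc)
    then show ?case by (simp add: left_diff_distrib)
  qed simp
  from this[of "1 - qexp x" n] nil show "qexp x * qexp_inv x = 1"
    by (simp add: qexp_inv_def)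
  with comm show "qexp_inv x * qexp x = 1" by simp
qed

section \<open>Commutation of the quasi-R-matrix with one generator\<close>

lemma qint_shift:
  "1 + qint q m * (iq * iq ^ m) = qint q (Suc m) * iq ^ m"
  "1 + qint q m * (q * q ^ m) = qint q (Suc m) * q ^ m"
proof -
  have s: "(q - iq) * qint q k = q ^ k - iq ^ k" for k
    by (simp add: qint_def)
  \<comment> \<open>After multiplication by \<open>q - iq\<close> the \<open>q\<close>-integers
    become differences of powers, and only \<open>q ^ m * iq ^ m = 1\<close> is needed.\<close>
  have *: "x - y + (a - b) * (y * b) = (x * a - y * b) * b"
    and **: "x - y + (a - b) * (x * a) = (x * a - y * b) * a" if "a * b = 1" for a b x y :: complex
    using that by algebra+
  have "(q - iq) * (1 + qint q m * (iq * iq ^ m)) = (q - iq) + (q ^ m - iq ^ m) * (iq * iq ^ m)"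
    by (simp only: semiring_class.distrib_left s mult.assoc[symmetric] mult_1_right)
  also have "\<dots> = (q * q ^ m - iq * iq ^ m) * iq ^ m"
    by (rule *[OF q_iq_power])
  also have "\<dots> = (q - iq) * (qint q (Suc m) * iq ^ m)"
    by (simp only: s mult.assoc[symmetric] power_Suc)
  finally show "1 + qint q m * (iq * iq ^ m) = qint q (Suc m) * iq ^ m"
    using q_minus_iq_nonzero by (metis mult_left_cancel)
  have "(q - iq) * (1 + qint q m * (q * q ^ m)) = (q - iq) + (q ^ m - iq ^ m) * (q * q ^ m)"
    by (simp only: semiring_class.distrib_left s mult.assoc[symmetric] mult_1_right)
  also have "\<dots> = (q * q ^ m - iq * iq ^ m) * q ^ m"
    by (rule **[OF q_iq_power])
  also have "\<dots> = (q - iq) * (qint q (Suc m) * q ^ m)"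
    by (simp only: s mult.assoc[symmetric] power_Suc)
  finally show "1 + qint q m * (q * q ^ m) = qint q (Suc m) * q ^ m"
    using q_minus_iq_nonzero by (metis mult_left_cancel)
qed

text \<open>The commutator of \<open>E\<close> with a power of \<open>F\<close>, by induction:
  \<open>k\<close> and \<open>ki\<close> pass each further \<open>f\<close> with opposite factors,
  and \<open>qint_shift\<close> collects the coefficients.\<close>

lemma F_power_shift:
  assumes "k * f = iq\<^sup>2 *c (f * k)" "ki * f = q\<^sup>2 *c (f * ki)"
    and "e * f = f * e + (1 / (q - iq)) *c (k - ki)"
  shows "e * f ^ Suc m = f ^ Suc m * e
    + (qint q (Suc m) / (q - iq)) *c (f ^ m * (iq ^ m *c k - q ^ m *c ki))"
proof (induction m)
  case 0
  show ?case using assms(3) by (simp add: qint_def)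
next
  case (Suc m)
  let ?s = "q - iq"
  have "e * f ^ Suc (Suc m) = (e * f ^ Suc m) * f"
    by (simp only: power_Suc2 mult.assoc)
  also have "\<dots> = f ^ Suc m * (e * f)
      + (qint q (Suc m) / ?s) *c (f ^ m * ((iq ^ m *c k - q ^ m *c ki) * f))"
    unfolding Suc by (simp add: semiring_class.distrib_right mult.assoc)
  also have "(iq ^ m *c k - q ^ m *c ki) * f = f * (iq ^ (m + 2) *c k - q ^ (m + 2) *c ki)"
    by (simp add: left_diff_distrib right_diff_distrib assms power2_eq_square mult_ac)
  also have "f ^ m * (f * (iq ^ (m + 2) *c k - q ^ (m + 2) *c ki))
      = f ^ Suc m * (iq ^ (m + 2) *c k - q ^ (m + 2) *c ki)"
    by (simp add: power_commutes flip: mult.assoc)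
  also have "f ^ Suc m * (e * f) = f ^ Suc (Suc m) * e + (1 / ?s) *c (f ^ Suc m * (k - ki))"
    by (simp only: assms(3) semiring_class.distrib_left mult_scaleX_right
        mult.assoc[symmetric] power_Suc2[symmetric])
  also have "f ^ Suc (Suc m) * e + (1 / ?s) *c (f ^ Suc m * (k - ki))
      + (qint q (Suc m) / ?s) *c (f ^ Suc m * (iq ^ (m + 2) *c k - q ^ (m + 2) *c ki))
    = f ^ Suc (Suc m) * e + ((1 + qint q (Suc m) * iq ^ (m + 2)) / ?s) *c (f ^ Suc m * k)
      - ((1 + qint q (Suc m) * q ^ (m + 2)) / ?s) *c (f ^ Suc m * ki)"
    by (simp only: right_diff_distrib mult_scaleX_right scaleX_diff_right scaleX_scaleX
        add_divide_distrib scaleX_add_left times_divide_eq_left) (simp add: algebra_simps)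
  also have "1 + qint q (Suc m) * iq ^ (m + 2) = qint q (Suc (Suc m)) * iq ^ Suc m"
    using qint_shift(1)[of "Suc m"] by (simp add: mult_ac)
  also have "1 + qint q (Suc m) * q ^ (m + 2) = qint q (Suc (Suc m)) * q ^ Suc m"
    using qint_shift(2)[of "Suc m"] by (simp add: mult_ac)
  finally show ?case
    by (simp add: right_diff_distrib scaleX_diff_right)
qed

text \<open>By \<open>cf_Suc\<close> the commutator of \<open>e\<close> with the summand of degree
  \<open>Suc m\<close> becomes a difference of two terms of degree \<open>m\<close>, which sum to
  \<open>qexp (a * f)\<close> times \<open>a * k\<close> on the right and times
  \<open>ki * a\<close> on the left. Abstract letters allow one use for \<open>E\<close> and one for
  \<open>F\<close>.\<close>

lemma qexp_E_intertwine:
  fixes a e f k ki :: "'a::complex_algebra"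
  assumes kf: "k * f = iq\<^sup>2 *c (f * k)" "ki * f = q\<^sup>2 *c (f * ki)"
    and ef: "e * f = f * e + (1 / (q - iq)) *c (k - ki)"
    and nil: "a ^ n = 0"
    and comm: "e * a = a * e" "f * a = a * f" "k * a = a * k" "ki * a = a * ki"
  shows "qexp (a * f) * (e + a * k) = (e + ki * a) * qexp (a * f)"
proof -
  let ?s = "q - iq"
  define t where "t m = a ^ Suc m * (f ^ m * (k - q ^ (2 * m) *c ki))" for m
  have af: "(a * f) ^ m = a ^ m * f ^ m" for m
    by (rule power_mult_distrib_comm) (simp add: comm)
  have ea: "e * a ^ m = a ^ m * e" and fa: "f ^ m * a = a * f ^ m"
    and ka: "ki * a ^ m = a ^ m * ki" for m
    using powers_commute[OF comm(1), of 1 m] powers_commute[OF comm(2), of m 1]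
      powers_commute[OF comm(4), of 1 m] by simp_all
  have kif: "ki * f ^ m = q ^ (2 * m) *c (f ^ m * ki)" for m
    using shift_power[OF kf(2), of m] by (simp add: power_mult)
  have step: "cf (Suc m) *c (e * (a * f) ^ Suc m - (a * f) ^ Suc m * e) = cf m *c t m"
    if "Suc m < n" for m
  proof -
    have "e * (a * f) ^ Suc m - (a * f) ^ Suc m * e = a ^ Suc m * (e * f ^ Suc m - f ^ Suc m * e)"
      unfolding af right_diff_distrib by (simp only: ea flip: mult.assoc)
    also have "e * f ^ Suc m - f ^ Suc m * e
        = (qint q (Suc m) / ?s) *c (f ^ m * (iq ^ m *c k - q ^ m *c ki))"
      unfolding F_power_shift[OF kf ef] by simp
    finally have "cf (Suc m) *c (e * (a * f) ^ Suc m - (a * f) ^ Suc m * e)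
        = (cf (Suc m) * qint q (Suc m) / ?s) *c (a ^ Suc m * (f ^ m * (iq ^ m *c k - q ^ m *c ki)))"
      by simp
    also have "\<dots> = (cf m * q ^ m) *c (a ^ Suc m * (f ^ m * (iq ^ m *c k - q ^ m *c ki)))"
      using q_minus_iq_nonzero by (simp only: cf_Suc[OF that]) (simp add: mult.commute)
    also have "\<dots> = cf m *c (a ^ Suc m * (f ^ m * (q ^ m *c (iq ^ m *c k - q ^ m *c ki))))"
      by simp
    also have "q ^ m *c (iq ^ m *c k - q ^ m *c ki) = k - q ^ (2 * m) *c ki"
      by (simp only: scaleX_diff_right scaleX_scaleX q_iq_power mult_2 power_add scaleX_one)
    finally show ?thesis by (simp add: t_def)
  qed
  have n: "n = Suc (n - 1)" using n_gt_1 by simp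
  have "e * qexp (a * f) - qexp (a * f) * e
      = (\<Sum>m<n. cf m *c (e * (a * f) ^ m - (a * f) ^ m * e))"
    by (simp add: qexp_def sum_distrib_left sum_distrib_right scaleX_diff_right sum_subtractf)
  also have "\<dots> = (\<Sum>m<n - 1. cf (Suc m) *c (e * (a * f) ^ Suc m - (a * f) ^ Suc m * e))"
    by (subst n, subst sum.lessThan_Suc_shift) simp
  also have "\<dots> = (\<Sum>m<n - 1. cf m *c t m)"
    by (intro sum.cong HOL.refl step) auto
  also have "\<dots> = (\<Sum>m<n. cf m *c t m)"
  proof -
    \<comment> \<open>The extra summand contains \<open>a ^ n = 0\<close>, so the range can be
      completed to that of \<open>qexp\<close>.\<close>
    have "t (n - 1) = 0" using nil n by (simp add: t_def del: power_Suc)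
    then show ?thesis by (subst (2) n, subst sum.lessThan_Suc) simp
  qed
  also have "\<dots> = (\<Sum>m<n. cf m *c ((a * f) ^ m * (a * k) - ki * a * (a * f) ^ m))"
  proof (intro sum.cong HOL.refl)
    fix m
    have "(a * f) ^ m * (a * k) = a ^ Suc m * (f ^ m * k)"
      by (simp add: af fa mult.assoc power_commutes flip: mult.assoc[of "f ^ m" a] mult.assoc[of "a ^ m" a])
    moreover have "ki * a * (a * f) ^ m = a ^ Suc m * (ki * f ^ m)"
      using ka[of "Suc m"] by (simp add: af flip: mult.assoc)
    ultimately show "cf m *c t m = cf m *c ((a * f) ^ m * (a * k) - ki * a * (a * f) ^ m)"
      by (simp add: t_def kif right_diff_distrib)
  qed
  also have "\<dots> = qexp (a * f) * (a * k) - ki * a * qexp (a * f)"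
    by (simp add: qexp_def sum_distrib_left sum_distrib_right scaleX_diff_right sum_subtractf)
  finally show ?thesis by (simp add: algebra_simps)
qed

text \<open>Moving \<open>k ^ i\<close> past \<open>e ^ m\<close> and \<open>l ^ j\<close> past
  \<open>f ^ m\<close> produces precisely the factor \<open>q^(2m(i - j))\<close> of
  \<open>Acoef\<close>; the rest of the coefficient separates. A general assignment \<open>g\<close>
  also covers the images under the coproduct.\<close>

lemma R_hat_eval:
  fixes g :: "nat \<times> gen \<Rightarrow> 'a::complex_algebra"
  defines "e \<equiv> g (0, E)" and "k \<equiv> g (0, K) + g (0, L)"
    and "f \<equiv> g (1, F)" and "l \<equiv> g (1, K) + g (1, L)"
  assumes ke: "k * e = q\<^sup>2 *c (e * k)" and lf: "l * f = iq\<^sup>2 *c (f * l)"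
    and comm: "e * f = f * e" "e * l = l * e" "k * f = f * k"
  shows "ev g (R_hat q n) = cartan k l * qexp (e * f)"
proof -
  have "ev g (R_hat q n) = (\<Sum>i<n. \<Sum>j<n. \<Sum>m<n. Acoef n q i j m *c (e ^ m * k ^ i * (f ^ m * l ^ j)))"
    by (simp add: R_hat_def map_concat sum_list_concat comp_def interv_sum_list_conv_sum_set_nat
        emb_def ev_relabel KL_def e_def k_def f_def l_def lessThan_atLeast0)
  also have "\<dots> = (\<Sum>i<n. \<Sum>j<n. \<Sum>m<n. (iq ^ (2 * i * j) / of_nat n) *c (k ^ i * l ^ j)
      * cf m *c (e * f) ^ m)"
  proof (intro sum.cong HOL.refl)
    fix i j m
    \<comment> \<open>The integer exponent is split into four natural ones, the negative ones
      expressed through \<open>iq\<close>.\<close>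
    have powi: "q powi (int a + int b - int c - int d) = q ^ a * q ^ b * iq ^ c * iq ^ d" for a b c d
      by (simp add: power_int_add power_int_diff power_inverse divide_inverse)
    have "int (m * (m - 1) div 2) + 2 * int m * (int i - int j) - 2 * int i * int j
      = int (m * (m - 1) div 2) + int (2 * i * m) - int (2 * j * m) - int (2 * i * j)"
      by (simp add: algebra_simps)
    then have coef: "Acoef n q i j m
        = iq ^ (2 * i * j) / of_nat n * cf m * (q ^ (2 * i * m) * iq ^ (2 * j * m))"
      unfolding Acoef_def cf_def by (simp only: powi) (simp add: mult_ac)
    have "k ^ i * e ^ m = q ^ (2 * i * m) *c (e ^ m * k ^ i)" for i m
    proof (induction i)
      case (Suc i)
      have "k * e ^ m = q ^ (2 * m) *c (e ^ m * k)"
        using shift_power[OF ke, of m] by (simp add: power_mult)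
      then have "k ^ Suc i * e ^ m = (q ^ (2 * i * m) * q ^ (2 * m)) *c (e ^ m * k ^ Suc i)"
        using Suc by (simp add: mult.assoc) (simp flip: mult.assoc)
      then show ?case by (simp add: algebra_simps flip: power_add)
    qed simp
    moreover have "l ^ i * f ^ m = iq ^ (2 * i * m) *c (f ^ m * l ^ i)" for i m
    proof (induction i)
      case (Suc i)
      have "l * f ^ m = iq ^ (2 * m) *c (f ^ m * l)"
        using shift_power[OF lf, of m] by (simp add: power_mult)
      then have "l ^ Suc i * f ^ m = (iq ^ (2 * i * m) * iq ^ (2 * m)) *c (f ^ m * l ^ Suc i)"
        using Suc by (simp add: mult.assoc) (simp flip: mult.assoc)
      then show ?case by (simp add: algebra_simps flip: power_add)
    qed simp
    moreover have "k ^ i * l ^ j * (e * f) ^ m = k ^ i * e ^ m * (l ^ j * f ^ m)"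
    proof -
      have "l ^ j * e ^ m = e ^ m * l ^ j"
        by (rule powers_commute) (simp add: comm)
      then show ?thesis
        by (simp add: power_mult_distrib_comm[OF comm(1)] mult.assoc)
           (simp flip: mult.assoc)
    qed
    ultimately have "k ^ i * l ^ j * (e * f) ^ m
        = (q ^ (2 * i * m) * iq ^ (2 * j * m)) *c (e ^ m * k ^ i * (f ^ m * l ^ j))"
      by (simp add: mult.commute)
    then show "Acoef n q i j m *c (e ^ m * k ^ i * (f ^ m * l ^ j))
        = (iq ^ (2 * i * j) / of_nat n) *c (k ^ i * l ^ j) * cf m *c (e * f) ^ m"
      by (simp add: coef mult_ac)
  qed
  also have "\<dots> = cartan k l * qexp (e * f)"
    by (simp only: cartan_def sum_distrib_right) (simp only: qexp_def sum_distrib_left)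
  finally show ?thesis .
qed

end

section \<open>R-matrix identities\<close>

definition kk :: "(gen \<Rightarrow> 'a::complex_algebra) \<Rightarrow> 'a" where "kk h = h K + h L"
definition kb :: "(gen \<Rightarrow> 'a::complex_algebra) \<Rightarrow> 'a" where "kb h = h Kb + h Lb"

text \<open>Such an \<open>h\<close> amounts to a homomorphism from the quotient algebra into
  \<open>'a\<close>.\<close>

locale uhat = root_of_unity +
  fixes h :: "gen \<Rightarrow> 'a::complex_algebra"
  assumes rels: "(s, t) \<in> Uhat_rel q n \<Longrightarrow> ev h s = ev h t"
begin

lemma gen_rels:
  "h K * h Kb * h K = h K" "h Kb * h K * h Kb = h Kb" "h K * h Kb = h Kb * h K"
  "h L * h Lb * h L = h L" "h Lb * h L * h Lb = h Lb" "h L * h Lb = h Lb * h L"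
  "h K * h Kb + h L * h Lb = 1"
  and gen_shift [simp]:
  "h K * h E = q\<^sup>2 *c (h E * h L)" "h L * h E = q\<^sup>2 *c (h E * h K)"
  "h Kb * h E = iq\<^sup>2 *c (h E * h Lb)" "h Lb * h E = iq\<^sup>2 *c (h E * h Kb)"
  "h K * h F = iq\<^sup>2 *c (h F * h L)" "h L * h F = iq\<^sup>2 *c (h F * h K)"
  "h Kb * h F = q\<^sup>2 *c (h F * h Lb)" "h Lb * h F = q\<^sup>2 *c (h F * h Kb)"
  and gen_comm: "h E * h F = h F * h E + (1 / (q - iq)) *c (kk h - kb h)"
  and gen_nil: "h K ^ n + h L ^ n = 1" "h E ^ n = 0" "h F ^ n = 0"
proof -
  have "\<forall>(s, t)\<in>Uhat_rel q n. ev h s = ev h t" using rels by auto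
  note r = this[unfolded Uhat_rel_def, simplified]
  show "h K * h Kb * h K = h K" "h Kb * h K * h Kb = h Kb" "h K * h Kb = h Kb * h K"
    "h L * h Lb * h L = h L" "h Lb * h L * h Lb = h Lb" "h L * h Lb = h Lb * h L"
    "h K * h Kb + h L * h Lb = 1"
    "h K * h E = q\<^sup>2 *c (h E * h L)" "h L * h E = q\<^sup>2 *c (h E * h K)"
    "h Kb * h E = iq\<^sup>2 *c (h E * h Lb)" "h Lb * h E = iq\<^sup>2 *c (h E * h Kb)"
    "h K * h F = iq\<^sup>2 *c (h F * h L)" "h L * h F = iq\<^sup>2 *c (h F * h K)"
    "h Kb * h F = q\<^sup>2 *c (h F * h Lb)" "h Lb * h F = q\<^sup>2 *c (h F * h Kb)"
    "h E ^ n = 0" "h F ^ n = 0"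
    using r by blast+
  show "h E * h F = h F * h E + (1 / (q - iq)) *c (kk h - kb h)"
    using r by (simp add: kk_def kb_def algebra_simps)
  have "h K ^ n + (h L ^ n - 1) = 0" using r by simp
  then show "h K ^ n + h L ^ n = 1" by (simp add: algebra_simps)
qed

text \<open>\<open>P = K * Kb\<close> and \<open>Q = L * Lb\<close> are complementary idempotents; \<open>K\<close>, \<open>Kb\<close> live on \<open>P\<close>
  and \<open>L\<close>, \<open>Lb\<close> on \<open>Q\<close>.\<close>

lemma gen_orthogonal:
  assumes "x \<in> {h K, h Kb}" "y \<in> {h L, h Lb}"
  shows "x * y = 0" "y * x = 0"
proof -
  let ?P = "h K * h Kb" and ?Q = "h L * h Lb"
  have P: "?P * x = x" "x * ?P = x"
    using assms(1) gen_rels(1-3) by (auto, (metis mult.assoc)+)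
  have Q: "?Q * y = y" "y * ?Q = y"
    using assms(2) gen_rels(4-6) by (auto, (metis mult.assoc)+)
  have PP: "?P * ?P = ?P" using gen_rels(1) by (simp flip: mult.assoc)
  have "?Q = 1 - ?P" using gen_rels(7) by (simp add: eq_diff_eq add.commute)
  then have "?P * ?Q = 0" "?Q * ?P = 0"
    using PP by (simp_all add: right_diff_distrib left_diff_distrib)
  then show "x * y = 0" "y * x = 0"
    using P Q by (metis mult.assoc mult_zero_left mult_zero_right)+
qed

lemma gen_orthogonal' [simp]:
  "h K * h L = 0" "h L * h K = 0" "h K * h Lb = 0" "h Lb * h K = 0"
  "h Kb * h L = 0" "h L * h Kb = 0" "h Kb * h Lb = 0" "h Lb * h Kb = 0"
  using gen_orthogonal by simp_all

lemma kk_kb [simp]: "kk h * kb h = 1" "kb h * kk h = 1"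
  using gen_rels(3,6,7)
  by (simp_all add: kk_def kb_def semiring_class.distrib_left semiring_class.distrib_right)

lemma kk_power_n [simp]: "kk h ^ n = 1"
  using n_gt_1 gen_nil(1) by (simp add: kk_def power_add_orthogonal)

text \<open>The twist exchanges \<open>K\<close> with \<open>L\<close> and \<open>Kb\<close> with
  \<open>Lb\<close>, so it disappears in the sums.\<close>

lemma kk_shift [simp]:
  "kk h * h E = q\<^sup>2 *c (h E * kk h)" "kb h * h E = iq\<^sup>2 *c (h E * kb h)"
  "kk h * h F = iq\<^sup>2 *c (h F * kk h)" "kb h * h F = q\<^sup>2 *c (h F * kb h)"
  by (simp_all add: kk_def kb_def semiring_class.distrib_left semiring_class.distrib_right
      scaleX_add_right add.commute)

lemma kk_gen_commute:
  "h K * kk h = kk h * h K" "h L * kk h = kk h * h L"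
  "h Kb * kk h = kk h * h Kb" "h Lb * kk h = kk h * h Lb"
  using gen_rels(3,6)
  by (simp_all add: kk_def semiring_class.distrib_left semiring_class.distrib_right)

lemmas tails = gen_shift[THEN assoc_tail] kk_shift[THEN assoc_tail] kk_kb[THEN assoc_tail]

end

section \<open>Two commuting legs: invertibility and quasi-cocommutativity\<close>

locale uhat2 = uhat n q h + other: uhat n q h' for n q and h h' :: "gen \<Rightarrow> 'a::complex_algebra" +
  assumes legs_commute [simp]: "h' x * h y = h y * h' x"
begin

lemma kk_legs_commute [simp]:
  "kk h' * h y = h y * kk h'" "h' x * kk h = kk h * h' x" "kk h' * kk h = kk h * kk h'"
  "kb h' * h y = h y * kb h'" "h' x * kb h = kb h * h' x" "kb h' * kb h = kb h * kb h'"
  "kk h' * kb h = kb h * kk h'" "kb h' * kk h = kk h * kb h'"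
  by (simp_all add: kk_def kb_def semiring_class.distrib_left semiring_class.distrib_right algebra_simps)

lemmas leg_tails = legs_commute[THEN assoc_tail] kk_legs_commute[THEN assoc_tail]

definition R :: 'a where "R = cartan (kk h) (kk h') * qexp (h E * h' F)"

definition Rinv :: 'a where "Rinv = qexp_inv (h E * h' F) * cartan (kb h) (kk h')"

lemma EF_nil: "(h E * h' F) ^ n = 0"
  by (simp add: power_mult_distrib_comm gen_nil)

text \<open>The Cartan factor is inverted by multiplicativity: \<open>kk h * kb h = 1\<close> and
  \<open>cartan 1 b = 1\<close>.\<close>

lemma R_Rinv: "R * Rinv = 1" "Rinv * R = 1"
proof -
  have "cartan (kk h) (kk h') * cartan (kb h) (kk h') = 1"
    "cartan (kb h) (kk h') * cartan (kk h) (kk h') = 1"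
    by (simp_all add: cartan_mult cartan_one)
  then show "R * Rinv = 1" "Rinv * R = 1"
    using qexp_inverse[OF EF_nil] unfolding R_def Rinv_def
    by (metis mult.assoc mult_1)+
qed

lemma cartan_swap: "cartan (kk h) (kk h') = cartan (kk h') (kk h)"
  by (rule cartan_sym) simp

text \<open>The factor \<open>qexp\<close> turns the coproduct of \<open>E\<close> into the
  intermediate form \<open>h' E + kb h' * h E\<close>; the Cartan factor then turns this into the
  opposite coproduct.\<close>

lemma R_E: "R * (h' E + h E * kk h') = (h E + h' E * kk h) * R"
proof -
  let ?C = "cartan (kk h) (kk h')"
  have 1: "qexp (h E * h' F) * (h' E + h E * kk h') = (h' E + kb h' * h E) * qexp (h E * h' F)"
    by (rule qexp_E_intertwine) (simp_all add: gen_nil other.gen_comm)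
  have "h E * ?C = ?C * (kb h' * h E)"
    by (rule cartan_shift_inverse) simp_all
  then have 2: "?C * kb h' * h E = h E * ?C" by (simp only: mult.assoc)
  have "(h' E * kk h) * ?C = ?C * (kb h * (h' E * kk h))"
    unfolding cartan_swap by (rule cartan_shift_inverse) (simp_all add: mult.assoc tails other.tails leg_tails)
  then have 3: "?C * h' E = h' E * kk h * ?C" by (simp add: tails)
  show ?thesis
    unfolding R_def
    by (simp only: mult.assoc 1)
      (simp only: semiring_class.distrib_left semiring_class.distrib_right mult.assoc[symmetric] 2 3 add.commute)
qed

lemma R_F: "R * (h F + kb h * h' F) = (h' F + kb h' * h F) * R"
proof -
  let ?C = "cartan (kk h) (kk h')"
  have fe: "h F * h E = h E * h F + (1 / (q - iq)) *c (kb h - kk h)"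
    by (simp add: gen_comm scaleX_diff_right)
  \<comment> \<open>The same intertwining lemma with \<open>h F\<close> as \<open>e\<close>,
    \<open>h E\<close> as \<open>f\<close>, and \<open>kb h\<close>, \<open>kk h\<close> as
    \<open>k\<close>, \<open>ki\<close>.\<close>
  have "qexp (h' F * h E) * (h F + h' F * kb h) = (h F + kk h * h' F) * qexp (h' F * h E)"
    by (rule qexp_E_intertwine) (simp_all add: other.gen_nil fe)
  then have 1: "qexp (h E * h' F) * (h F + kb h * h' F) = (h F + kk h * h' F) * qexp (h E * h' F)"
    by simp
  have "h' F * ?C = ?C * (kk h * h' F)"
    unfolding cartan_swap by (rule cartan_shift) simp_all
  then have 2: "?C * kk h * h' F = h' F * ?C" by (simp only: mult.assoc)
  have "(kb h' * h F) * ?C = ?C * (kk h' * (kb h' * h F))"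
    by (rule cartan_shift) (simp_all add: mult.assoc tails other.tails leg_tails)
  then have 3: "?C * h F = kb h' * h F * ?C" by (simp only: mult.assoc[symmetric]) (simp add: mult.assoc)
  show ?thesis
    unfolding R_def
    by (simp only: mult.assoc 1)
      (simp only: semiring_class.distrib_left semiring_class.distrib_right mult.assoc[symmetric] 2 3 add.commute)
qed

lemma R_commute:
  assumes "d * kk h = kk h * d" "d * kk h' = kk h' * d" "d * (h E * h' F) = h E * h' F * d"
  shows "R * d = d * R"
proof -
  have "qexp (h E * h' F) * d = d * qexp (h E * h' F)"
    by (rule qexp_intertwine) (simp add: assms(3))
  with cartan_commute[OF assms(1,2)] show ?thesis
    unfolding R_def by (metis mult.assoc)
qed

text \<open>These coproducts are invariant under the flip, so \<open>R\<close> has to commute with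
  them. Passing \<open>h E * h' F\<close> exchanges the two summands while the factors
  \<open>q^2\<close> and \<open>q^-2\<close> cancel.\<close>

lemma R_grouplike:
  assumes "d = h x * h' y + h x' * h' y'"
    and "(x, y, x', y') \<in> {(K, K, L, L), (Kb, Kb, Lb, Lb), (L, K, K, L), (Lb, Kb, Kb, Lb)}"
  shows "R * d = d * R"
proof (rule R_commute)
  note comm = kk_gen_commute other.kk_gen_commute
  show "d * kk h = kk h * d" "d * kk h' = kk h' * d"
    unfolding assms(1) using assms(2)
    by (auto simp: semiring_class.distrib_left semiring_class.distrib_right mult.assoc
        comm comm[THEN assoc_tail] leg_tails)
  show "d * (h E * h' F) = h E * h' F * d"
    unfolding assms(1) using assms(2)
    by (auto simp: semiring_class.distrib_left semiring_class.distrib_right mult.assoc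
        tails other.tails leg_tails scaleX_add_right add.commute)
qed

lemma R_hat_legs:
  fixes g :: "nat \<times> gen \<Rightarrow> 'a"
  assumes "\<And>x. g (0, x) = h x" "\<And>x. g (1, x) = h' x"
  shows "ev g (R_hat q n) = R"
  unfolding R_def kk_def assms(1,2)[symmetric]
  by (rule R_hat_eval) (simp_all add: assms del: One_nat_def flip: kk_def)

end

section \<open>Three commuting legs: the hexagon identities\<close>

locale uhat3 = u01: uhat2 n q h0 h1 + u02: uhat2 n q h0 h2 + u12: uhat2 n q h1 h2
  for n q and h0 h1 h2 :: "gen \<Rightarrow> 'a::complex_algebra"
begin

lemmas normal = mult.assoc u01.tails u01.other.tails u02.other.tails
  u01.leg_tails u02.leg_tails u12.leg_tails

lemma R_coproduct_left:
  "u01.cartan (kk h0 * kk h1) (kk h2) * u01.qexp ((h1 E + h0 E * kk h1) * h2 F) = u02.R * u12.R"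
proof -
  \<comment> \<open>The factor \<open>kk h1\<close> in \<open>?u\<close> is the one produced by
    pulling the Cartan part of legs 1 and 2 through \<open>qexp (h0 E * h2 F)\<close>.\<close>
  let ?u = "kk h1 * (h0 E * h2 F)" and ?v = "h1 E * h2 F"
  have sum: "(h1 E + h0 E * kk h1) * h2 F = ?u + ?v"
    by (simp add: semiring_class.distrib_right normal)
  have exp: "u01.qexp (?u + ?v) = u01.qexp ?u * u01.qexp ?v"
  proof (rule u01.qexp_add)
    show "?v * ?u = (inverse q)\<^sup>2 *c (?u * ?v)"
      by (simp add: normal)
    show "?u ^ i * ?v ^ j = 0" if "n \<le> i + j" for i j
      using nilpotent_product[of "kk h1 * h0 E" "h2 F" "h1 E" n i j] that
      by (simp add: normal u02.other.gen_nil)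
  qed
  have car: "u01.cartan (kk h0 * kk h1) (kk h2)
      = u01.cartan (kk h0) (kk h2) * u01.cartan (kk h1) (kk h2)"
    by (rule u01.cartan_mult[symmetric]) simp_all
  have move: "u01.qexp (h0 E * h2 F) * u01.cartan (kk h1) (kk h2)
      = u01.cartan (kk h1) (kk h2) * u01.qexp ?u"
  proof (rule u01.qexp_intertwine)
    show "h0 E * h2 F * u01.cartan (kk h1) (kk h2) = u01.cartan (kk h1) (kk h2) * ?u"
      unfolding u12.cartan_swap by (rule u01.cartan_shift) (simp_all add: normal)
  qed
  show ?thesis
    unfolding sum exp car u02.R_def u12.R_def
    by (simp only: mult.assoc) (simp only: mult.assoc[symmetric] move)
qed

lemma R_coproduct_right:
  "u01.cartan (kk h0) (kk h1 * kk h2) * u01.qexp (h0 E * (h1 F + kb h1 * h2 F)) = u02.R * u01.R"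
proof -
  let ?u = "kb h1 * (h0 E * h2 F)" and ?v = "h0 E * h1 F"
  have sum: "h0 E * (h1 F + kb h1 * h2 F) = ?u + ?v"
    by (simp add: semiring_class.distrib_left normal add.commute)
  have exp: "u01.qexp (?u + ?v) = u01.qexp ?u * u01.qexp ?v"
  proof (rule u01.qexp_add)
    show "?v * ?u = (inverse q)\<^sup>2 *c (?u * ?v)"
      by (simp add: normal)
    show "?u ^ i * ?v ^ j = 0" if "n \<le> i + j" for i j
      using nilpotent_product[of "kb h1 * h2 F" "h0 E" "h1 F" n i j] that
      by (simp add: normal u01.gen_nil)
  qed
  have car: "u01.cartan (kk h0) (kk h1 * kk h2)
      = u01.cartan (kk h0) (kk h2) * u01.cartan (kk h0) (kk h1)"
  proof -
    \<comment> \<open>Symmetry brings the product into the first argument, where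
      \<open>cartan_mult\<close> applies.\<close>
    have "u01.cartan (kk h0) (kk h1 * kk h2) = u01.cartan (kk h2 * kk h1) (kk h0)"
      by (subst u01.cartan_sym) (simp_all add: normal)
    also have "\<dots> = u01.cartan (kk h2) (kk h0) * u01.cartan (kk h1) (kk h0)"
      by (rule u01.cartan_mult[symmetric]) simp_all
    finally show ?thesis by (simp add: u01.cartan_swap u02.cartan_swap)
  qed
  have move: "u01.qexp (h0 E * h2 F) * u01.cartan (kk h0) (kk h1)
      = u01.cartan (kk h0) (kk h1) * u01.qexp ?u"
  proof (rule u01.qexp_intertwine)
    show "h0 E * h2 F * u01.cartan (kk h0) (kk h1) = u01.cartan (kk h0) (kk h1) * ?u"
      by (rule u01.cartan_shift_inverse) (simp_all add: normal)
  qed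
  show ?thesis
    unfolding sum exp car u02.R_def u01.R_def
    by (simp only: mult.assoc) (simp only: mult.assoc[symmetric] move)
qed

lemma R_hat_eval_left:
  assumes "g (0, E) = h1 E + h0 E * kk h1" "g (0, K) + g (0, L) = kk h0 * kk h1"
    and "g (Suc 0, F) = h2 F" "g (Suc 0, K) + g (Suc 0, L) = kk h2"
  shows "ev g (R_hat q n) = u02.R * u12.R"
proof -
  have "ev g (R_hat q n) = u01.cartan (g (0, K) + g (0, L)) (g (1, K) + g (1, L))
      * u01.qexp (g (0, E) * g (1, F))"
    by (rule u01.R_hat_eval) (simp_all add: assms normal scaleX_add_right
        semiring_class.distrib_left semiring_class.distrib_right)
  then show ?thesis by (simp add: assms R_coproduct_left)
qed

lemma R_hat_eval_right:
  assumes "g (0, E) = h0 E" "g (0, K) + g (0, L) = kk h0"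
    and "g (Suc 0, F) = h1 F + kb h1 * h2 F" "g (Suc 0, K) + g (Suc 0, L) = kk h1 * kk h2"
  shows "ev g (R_hat q n) = u02.R * u01.R"
proof -
  have "ev g (R_hat q n) = u01.cartan (g (0, K) + g (0, L)) (g (1, K) + g (1, L))
      * u01.qexp (g (0, E) * g (1, F))"
    by (rule u01.R_hat_eval) (simp_all add: assms normal scaleX_add_right
        semiring_class.distrib_left semiring_class.distrib_right)
  then show ?thesis by (simp add: assms R_coproduct_right)
qed

end

section \<open>Elements represented by terms\<close>

lemma range_ev_add: "a \<in> range (ev f) \<Longrightarrow> b \<in> range (ev f) \<Longrightarrow> a + b \<in> range (ev f)"
  by (auto simp flip: ev.simps(3))

lemma range_ev_mult: "a \<in> range (ev f) \<Longrightarrow> b \<in> range (ev f) \<Longrightarrow> a * b \<in> range (ev f)"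
  by (auto simp flip: ev.simps(4))

lemma range_ev_scaleX: "a \<in> range (ev f) \<Longrightarrow> c *c a \<in> range (ev f)"
  using range_ev_mult[OF rangeI[of "ev f" "Scal c"], of a] by simp

lemma range_ev_one: "1 \<in> range (ev f)"
  using rangeI[of "ev f" "Scal 1"] by simp

lemma range_ev_diff: "a \<in> range (ev f) \<Longrightarrow> b \<in> range (ev f) \<Longrightarrow> a - b \<in> range (ev f)"
  using range_ev_add[OF _ range_ev_scaleX, of a f b "-1"] by (simp add: scaleX_minus_left)

lemma range_ev_sum: "(\<And>i. i \<in> I \<Longrightarrow> a i \<in> range (ev f)) \<Longrightarrow> sum a I \<in> range (ev f)"
proof (induction I rule: infinite_finite_induct)
  case (infinite A)
  then show ?case using rangeI[of "ev f" "Scal 0"] by simp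
next
  case empty
  then show ?case using rangeI[of "ev f" "Scal 0"] by simp
qed (simp add: range_ev_add)

lemma range_ev_power: "a \<in> range (ev f) \<Longrightarrow> a ^ m \<in> range (ev f)"
  by (induction m) (simp_all add: range_ev_one range_ev_mult)

lemmas range_ev = range_ev_add range_ev_mult range_ev_scaleX range_ev_one range_ev_diff
  range_ev_sum range_ev_power

lemma (in root_of_unity) range_ev_qexp_inv: "x \<in> range (ev f) \<Longrightarrow> qexp_inv x \<in> range (ev f)"
  unfolding qexp_inv_def qexp_def by (intro range_ev)

lemma (in root_of_unity) range_ev_cartan:
  "a \<in> range (ev f) \<Longrightarrow> b \<in> range (ev f) \<Longrightarrow> cartan a b \<in> range (ev f)"
  unfolding cartan_def by (intro range_ev)

text \<open>The inverse found in the ring must be the value of a term to serve as witness in the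
  presented algebra.\<close>

lemma (in uhat2) range_ev_Rinv:
  assumes "\<And>x. h x \<in> range (ev f)" "\<And>x. h' x \<in> range (ev f)"
  shows "Rinv \<in> range (ev f)"
  unfolding Rinv_def kk_def kb_def
  by (intro range_ev_qexp_inv range_ev_cartan range_ev assms)

section \<open>Transfer to the presented tensor powers\<close>

text \<open>The counit is a character of the quotient algebra; applied to each tensor factor it is
  the \<open>\<chi>\<close> filling the foreign indices of \<open>class_at\<close>.\<close>

definition counit :: "gen \<Rightarrow> complex" where
  "counit x = (if x \<in> {K, Kb} then 1 else 0)"

context root_of_unity
begin

lemma counit_rel:
  assumes "(s, t) \<in> Uhat_rel q n"
  shows "ev counit s = ev counit t"
  using assms n_gt_1
  by (auto simp: Uhat_rel_def counit_def scaleX_complex_def)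

definition tgen :: "nat \<Rightarrow> nat \<times> gen \<Rightarrow> (nat \<times> gen) palg" where
  "tgen k p = class_at (tens_rel q n k) (\<lambda>p. counit (snd p)) (Gen p)"

text \<open>The bridge back to terms: equality in the product ring is read off at the component of
  the tensor relations.\<close>

lemma alg_eq_if_ev_eq:
  assumes "ev (tgen k) a = ev (tgen k) b"
  shows "alg_eq (tens_rel q n k) a b"
proof (rule class_at_eqD)
  show "class_at (tens_rel q n k) (\<lambda>p. counit (snd p)) a
      = class_at (tens_rel q n k) (\<lambda>p. counit (snd p)) b"
    using assms by (subst (1 2) class_at_ev) (simp add: tgen_def[abs_def])
qed

lemma ev_tgen_rel:
  assumes "(s, t) \<in> tens_rel q n k"
  shows "ev (tgen k) s = ev (tgen k) t"
proof -
  have "ev (\<lambda>p. counit (snd p)) s = ev (\<lambda>p. counit (snd p)) t"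
    using assms by (auto simp: tens_rel_def ev_relabel counit_rel)
  then have "class_at (tens_rel q n k) (\<lambda>p. counit (snd p)) s
      = class_at (tens_rel q n k) (\<lambda>p. counit (snd p)) t"
    by (intro class_at_eqI alg_eq.rel assms)
  then show ?thesis
    by (subst (asm) (1 2) class_at_ev) (simp add: tgen_def[abs_def])
qed

lemma uhat2_tgen:
  assumes "i < k" "j < k" "i \<noteq> j"
  shows "uhat2 n q (\<lambda>x. tgen k (i, x)) (\<lambda>x. tgen k (j, x))"
proof -
  have "uhat n q (\<lambda>x. tgen k (l, x))" if "l < k" for l
  proof unfold_locales
    fix s t assume "(s, t) \<in> Uhat_rel q n"
    with that have "(alg_relabel (Pair l) s, alg_relabel (Pair l) t) \<in> tens_rel q n k"
      unfolding tens_rel_def by blast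
    from ev_tgen_rel[OF this] show "ev (\<lambda>x. tgen k (l, x)) s = ev (\<lambda>x. tgen k (l, x)) t"
      by (simp add: ev_relabel)
  qed
  moreover have "tgen k (j, x) * tgen k (i, y) = tgen k (i, y) * tgen k (j, x)" for x y
  proof -
    have "(Mul (Gen (j, x)) (Gen (i, y)), Mul (Gen (i, y)) (Gen (j, x))) \<in> tens_rel q n k"
      using assms unfolding tens_rel_def by blast
    from ev_tgen_rel[OF this] show ?thesis by simp
  qed
  ultimately show ?thesis
    using assms by (simp add: uhat2_def uhat2_axioms_def)
qed

lemma R_hat_quasitriangular:
  defines "Rel \<equiv> tens_rel q n 2"
  shows "\<exists>r. alg_eq Rel (Mul (R_hat q n) r) (Scal 1) \<and> alg_eq Rel (Mul r (R_hat q n)) (Scal 1)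
    \<and> (\<forall>b. alg_eq Rel (Delta_cop b) (Mul (Mul (R_hat q n) (Delta b)) r))"
proof -
  define g where "g = tgen 2"
  interpret uhat2 n q "\<lambda>x. g (0, x)" "\<lambda>x. g (Suc 0, x)"
    unfolding g_def by (rule uhat2_tgen) auto
  have R: "ev g (R_hat q n) = R" by (rule R_hat_legs) simp_all
  have gen: "g p \<in> range (ev g)" for p using rangeI[of "ev g" "Gen p"] by simp
  have "Rinv \<in> range (ev g)" by (intro range_ev_Rinv gen)
  then obtain r where r: "ev g r = Rinv" by auto
  \<comment> \<open>Both coproducts are homomorphisms, so the intertwining relation spreads from
    generators to all terms.\<close>
  have comm: "R * ev g (Delta b) = ev g (Delta_cop b) * R" for b
  proof (induction b)
    case (Gen x)
    show ?case
    proof (cases x)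
      case E
      with R_E show ?thesis
        by (simp add: Delta_def Delta_cop_def ev_relabel kk_def)
    next
      case F
      with R_F show ?thesis
        by (simp add: Delta_def Delta_cop_def ev_relabel kb_def)
    next
      case K
      with R_grouplike[OF HOL.refl, of K K L L] show ?thesis
        by (simp add: Delta_def Delta_cop_def ev_relabel)
    next
      case Kb
      with R_grouplike[OF HOL.refl, of Kb Kb Lb Lb] show ?thesis
        by (simp add: Delta_def Delta_cop_def ev_relabel)
    next
      case L
      with R_grouplike[OF HOL.refl, of L K K L] show ?thesis
        by (simp add: Delta_def Delta_cop_def ev_relabel add.commute)
    next
      case Lb
      with R_grouplike[OF HOL.refl, of Lb Kb Kb Lb] show ?thesis
        by (simp add: Delta_def Delta_cop_def ev_relabel add.commute)
    qed
  next
    case (Scal c)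
    show ?case by (simp add: Delta_def Delta_cop_def ev_relabel)
  next
    case (Add a b)
    then show ?case
      by (simp add: Delta_def Delta_cop_def ev_relabel semiring_class.distrib_left semiring_class.distrib_right)
  next
    case (Mul a b)
    have "R * (ev g (Delta a) * ev g (Delta b)) = ev g (Delta_cop a) * (R * ev g (Delta b))"
      using Mul(1) by (simp flip: mult.assoc)
    also have "\<dots> = ev g (Delta_cop a) * ev g (Delta_cop b) * R"
      by (simp add: Mul(2) mult.assoc)
    finally show ?case by (simp add: Delta_def Delta_cop_def alg_relabel_def)
  qed
  have "ev g (Delta_cop b) = R * ev g (Delta b) * Rinv" for b
    unfolding comm mult.assoc by (simp add: R_Rinv)
  then show ?thesis
    unfolding Rel_def
    by (intro exI[of _ r] conjI allI alg_eq_if_ev_eq; fold g_def) (simp_all add: R r R_Rinv)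
qed

lemma R_hat_hexagons:
  defines "Rel \<equiv> tens_rel q n 3"
  shows "alg_eq Rel (Delta_id (R_hat q n)) (Mul (legs 0 2 (R_hat q n)) (legs 1 2 (R_hat q n)))"
    and "alg_eq Rel (id_Delta (R_hat q n)) (Mul (legs 0 2 (R_hat q n)) (legs 0 1 (R_hat q n)))"
proof -
  define g where "g = tgen 3"
  have u: "uhat2 n q (\<lambda>x. g (i, x)) (\<lambda>x. g (j, x))" if "i < 3" "j < 3" "i \<noteq> j" for i j
    unfolding g_def using that by (rule uhat2_tgen)
  interpret uhat3 n q "\<lambda>x. g (0, x)" "\<lambda>x. g (Suc 0, x)" "\<lambda>x. g (2, x)"
    unfolding uhat3_def by (intro conjI u) auto
  have legs: "ev g (legs 0 1 (R_hat q n)) = u01.R" "ev g (legs 0 2 (R_hat q n)) = u02.R"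
    "ev g (legs 1 2 (R_hat q n)) = u12.R"
    unfolding legs_def ev_relabel
    by (rule u01.R_hat_legs u02.R_hat_legs u12.R_hat_legs; simp)+
  \<comment> \<open>By \<open>ev_subst\<close> the coproduct becomes a new assignment of the
    generators, to which the factorisation of the R-matrix applies directly.\<close>
  have "ev g (Delta_id (R_hat q n)) = u02.R * u12.R"
    unfolding Delta_id_def ev_subst
    by (rule R_hat_eval_left) (simp_all add: kk_def semiring_class.distrib_left semiring_class.distrib_right add_ac)
  then show "alg_eq Rel (Delta_id (R_hat q n)) (Mul (legs 0 2 (R_hat q n)) (legs 1 2 (R_hat q n)))"
    unfolding Rel_def by (intro alg_eq_if_ev_eq; fold g_def) (simp add: legs del: One_nat_def)
  have "ev g (id_Delta (R_hat q n)) = u02.R * u01.R"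
    unfolding id_Delta_def ev_subst
    by (rule R_hat_eval_right)
      (simp_all add: kk_def kb_def alg_relabel_def numeral_2_eq_2 semiring_class.distrib_left semiring_class.distrib_right add_ac)
  then show "alg_eq Rel (id_Delta (R_hat q n)) (Mul (legs 0 2 (R_hat q n)) (legs 0 1 (R_hat q n)))"
    unfolding Rel_def by (intro alg_eq_if_ev_eq; fold g_def) (simp add: legs del: One_nat_def)
qed

end

theorem mainTheorem12:
  fixes n :: nat and q :: complex
  assumes "n > 1" and "odd n" and "primitive_root n q"
  shows "\<exists>Rinv.
           alg_eq (tens_rel q n 2) (Mul (R_hat q n) Rinv) (Scal 1)
         \<and> alg_eq (tens_rel q n 2) (Mul Rinv (R_hat q n)) (Scal 1)
         \<and> (\<forall>b. alg_eq (tens_rel q n 2) (Delta_cop b) (Mul (Mul (R_hat q n) (Delta b)) Rinv))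
       \<and> alg_eq (tens_rel q n 3) (Delta_id (R_hat q n))
           (Mul (legs 0 2 (R_hat q n)) (legs 1 2 (R_hat q n)))
       \<and> alg_eq (tens_rel q n 3) (id_Delta (R_hat q n))
           (Mul (legs 0 2 (R_hat q n)) (legs 0 1 (R_hat q n)))"
proof -
  interpret root_of_unity n q by unfold_locales (rule assms)+
  from R_hat_quasitriangular R_hat_hexagons show ?thesis by blast
qed

end
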